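(* Let $\mu>0$ and consider the Boussinesq system of water waves $$\partial_t\begin{pmatrix}u \\ v\end{pmatrix}=\begin{pmatrix}0&-\partial_x-\mu\partial_{xxx} \\ -\partial_x&0\end{pmatrix}\begin{pmatrix}u \\ v\end{pmatrix}+\begin{pmatrix}\partial_x(uv) \\ 0\end{pmatrix},\qquad x\in\mathbb T=\mathbb R/\mathbb Z,$$ written $\dot z=\mathcal X(z)$, $z=(u,v)$. Assume that $\ell=1$, i.e. $\mu\in[\frac{1}{8\pi},\frac{1}{2\pi})$. Fix a Diophantine exponent $\nu>\ell$ and a large regularity exponent $m$. Then there exist three explicit functions $a,b_d,b_a:\mathbb R^+\to\mathbb R^+$ with $a(s)\to0$ and $b_d(s),b_a(s)\to\infty$ as $s\to0$ such that, for $\varepsilon$ sufficiently small, the following holds. Let $B_{a(\varepsilon)}(\omega^0)\subset\mathbb R^\ell$ be the ball of radius $a(\varepsilon)$ around $\omega^0$. For every $\omega\in\mathcal D(b_d(\varepsilon),\nu)\cap B_{a(\varepsilon)}(\omega^0)$ there exists an analytic embedding $K:\mathbb T^\ell\to X=H^{\rho,m}(\mathbb T)\times H^{\rho,m+1}(\mathbb T)$ solving the invariance equation $$\mathcal X\circ K=DK\cdot\omega .$$ Furthermore, $$\frac{|\mathcal D(b_d(\varepsilon),\nu)\cap B_{a(\varepsilon)}(\omega^0)|}{|B_{a(\varepsilon)}(\omega^0)|}\to1\quad(\varepsilon\to0).$$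
   Context: For $\rho>0$, $m\in\mathbb N$, $H^{\rho,m}(\mathbb T)$ is the space of analytic functions $f$ in the strip of width $\rho$ with $\|f\|_{\rho,m}^2=\sum_{k\in\mathbb Z}|f_k|^2e^{4\pi\rho|k|}(|k|^{2m}+1)<\infty$, $f_k$ the Fourier coefficients; $\rho>0$ is fixed. $\mathbb T^\ell=\mathbb R^\ell/\mathbb Z^\ell$. The eigenvalues of the linearization at $(0,0)$ are $\pm2\pi i|k|\sqrt{1-4\pi^2\mu k^2}$, $k\in\mathbb Z$. With $\{k_1,\dots,k_\ell\}=\{k\in\mathbb Z:k>0,\ 1-4\pi^2\mu k^2\ge0\}$ (so that $\ell$ is the number of such $k$), $\omega^0$ is the vector of the corresponding real frequencies, with components $|k_j|\sqrt{1-4\pi^2\mu k_j^2}$ (eigenvalue divided by $2\pi i$, since angles have period $1$). $\mathcal D(\kappa,\nu)$ is the set of $\omega\in\mathbb R^\ell$ with $|\omega\cdot k|^{-1}\le\kappa|k|^\nu$ for all $k\in\mathbb Z^\ell\setminus\{0\}$, where $|k|=|k_1|+\dots+|k_\ell|$. $|\cdot|$ of a set denotes Lebesgue measure.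
   Formalization: The printed interval μ∈[1/(8π),1/(2π)) gives ℓ=0 under the stated definition of ℓ, so no ω⁰ exists there; the formal theorem assumes ℓ=1 itself, i.e. 1/(16π²)<μ≤1/(4π²), instead of that interval. *)

theory Defs
  imports "HOL-Analysis.Analysis"
begin

definition strip :: "real \<Rightarrow> complex set" where
  "strip \<rho> = {z. \<bar>Im z\<bar> < \<rho>}"

definition fourier_coeff :: "(complex \<Rightarrow> complex) \<Rightarrow> int \<Rightarrow> complex" where
  "fourier_coeff f k =
     integral {0..1::real} (\<lambda>x. f (of_real x) * cis (- (2 * pi * of_int k * x)))"

definition H_term :: "real \<Rightarrow> nat \<Rightarrow> (complex \<Rightarrow> complex) \<Rightarrow> int \<Rightarrow> real" where
  "H_term \<rho> m f k =
     (cmod (fourier_coeff f k))\<^sup>2 * exp (4 * pi * \<rho> * \<bar>of_int k\<bar>) * (\<bar>of_int k\<bar> ^ (2 * m) + 1)"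

text \<open>
  Elements are functions on the open strip, extended by \<open>0\<close> outside it. This convention makes
  equality of elements the same as equality of HOL functions, and it is respected by linear
  combinations.
\<close>
definition H_space :: "real \<Rightarrow> nat \<Rightarrow> (complex \<Rightarrow> complex) set" where
  "H_space \<rho> m =
     {f. f holomorphic_on strip \<rho> \<and> (\<forall>z\<in>strip \<rho>. f (z + 1) = f z) \<and>
         (\<forall>z. z \<notin> strip \<rho> \<longrightarrow> f z = 0) \<and> H_term \<rho> m f summable_on UNIV}"

definition H_norm :: "real \<Rightarrow> nat \<Rightarrow> (complex \<Rightarrow> complex) \<Rightarrow> real" where
  "H_norm \<rho> m f = sqrt (\<Sum>\<^sub>\<infinity>k. H_term \<rho> m f k)"

text \<open>A pair \<open>(u, v)\<close> of functions is represented by the function \<open>x \<mapsto> (u x, v x)\<close>.\<close>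
type_synonym state = "complex \<Rightarrow> complex \<times> complex"

definition X_space :: "real \<Rightarrow> nat \<Rightarrow> state set" where
  "X_space \<rho> m = {z. fst \<circ> z \<in> H_space \<rho> m \<and> snd \<circ> z \<in> H_space \<rho> (m + 1)}"

definition X_norm :: "real \<Rightarrow> nat \<Rightarrow> state \<Rightarrow> real" where
  "X_norm \<rho> m z = sqrt ((H_norm \<rho> m (fst \<circ> z))\<^sup>2 + (H_norm \<rho> (m + 1) (snd \<circ> z))\<^sup>2)"

definition real_on_axis :: "state \<Rightarrow> bool" where
  "real_on_axis z \<longleftrightarrow> (\<forall>x::real. fst (z (of_real x)) \<in> \<real> \<and> snd (z (of_real x)) \<in> \<real>)"

definition boussinesq :: "real \<Rightarrow> state \<Rightarrow> state" where
  "boussinesq \<mu> z =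
     (let u = fst \<circ> z; v = snd \<circ> z in
      (\<lambda>x. (- deriv v x - of_real \<mu> * (deriv ^^ 3) v x + deriv (\<lambda>y. u y * v y) x,
            - deriv u x)))"

text \<open>
  The number \<open>\<ell>\<close> is the cardinality of this set. For \<open>\<mu> > 0\<close> it equals \<open>1\<close>
  exactly when \<open>1 / (16 * pi\<^sup>2) < \<mu> \<le> 1 / (4 * pi\<^sup>2)\<close>.
\<close>
definition central_modes :: "real \<Rightarrow> int set" where
  "central_modes \<mu> = {k. k > 0 \<and> 1 - 4 * pi\<^sup>2 * \<mu> * (of_int k)\<^sup>2 \<ge> 0}"

definition central_freq :: "real \<Rightarrow> ('l::finite \<Rightarrow> int) \<Rightarrow> real ^ 'l" where
  "central_freq \<mu> k =
     (\<chi> j. \<bar>of_int (k j)\<bar> * sqrt (1 - 4 * pi\<^sup>2 * \<mu> * (of_int (k j))\<^sup>2))"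

text \<open>
  As \<open>inverse 0 = 0\<close> in HOL, the condition that \<open>\<omega> \<bullet> k\<close> is nonzero has to be explicit.
\<close>
definition diophantine :: "real \<Rightarrow> real \<Rightarrow> (real ^ 'l::finite) set" where
  "diophantine \<kappa> \<nu> =
     {\<omega>. \<forall>k :: int ^ 'l. k \<noteq> 0 \<longrightarrow>
        (let d = (\<Sum>i\<in>UNIV. \<omega> $ i * of_int (k $ i)) in
         d \<noteq> 0 \<and> inverse \<bar>d\<bar> \<le> \<kappa> * (\<Sum>i\<in>UNIV. \<bar>of_int (k $ i)\<bar>) powr \<nu>)}"

text \<open>
  Maps from the torus are represented by maps on \<open>real ^ 'l\<close> that are invariant under integer
  translations. Real analyticity means local expansion into a multivariate power series with
  coefficients in \<open>X\<close>, indexed by the multi-indices \<open>'l \<Rightarrow> nat\<close>, that converges absolutely in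
  the norm of \<open>X\<close>.
\<close>
definition X_analytic :: "real \<Rightarrow> nat \<Rightarrow> (real ^ 'l::finite \<Rightarrow> state) \<Rightarrow> bool" where
  "X_analytic \<rho> m K \<longleftrightarrow>
     (\<forall>\<theta>. \<exists>(c :: ('l \<Rightarrow> nat) \<Rightarrow> state) r. r > 0 \<and> (\<forall>\<alpha>. c \<alpha> \<in> X_space \<rho> m) \<and>
        (\<forall>h. norm h < r \<longrightarrow>
           (\<lambda>\<alpha>. (\<Prod>i\<in>UNIV. \<bar>h $ i\<bar> ^ \<alpha> i) * X_norm \<rho> m (c \<alpha>)) summable_on UNIV \<and>
           ((\<lambda>F. X_norm \<rho> m
                  (\<lambda>x. K (\<theta> + h) x - (\<Sum>\<alpha>\<in>F. (\<Prod>i\<in>UNIV. (h $ i) ^ \<alpha> i) *\<^sub>R c \<alpha> x))) \<longlongrightarrow> 0)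
             (finite_subsets_at_top UNIV)))"

text \<open>The linear map from \<open>real ^ 'l\<close> to \<open>X\<close> whose columns are the \<open>D j\<close>.\<close>
definition lin_map :: "('l::finite \<Rightarrow> state) \<Rightarrow> real ^ 'l \<Rightarrow> state" where
  "lin_map D h = (\<lambda>x. \<Sum>j\<in>UNIV. h $ j *\<^sub>R D j x)"

definition has_X_derivative ::
  "real \<Rightarrow> nat \<Rightarrow> (real ^ 'l::finite \<Rightarrow> state) \<Rightarrow> ('l \<Rightarrow> state) \<Rightarrow> real ^ 'l \<Rightarrow> bool" where
  "has_X_derivative \<rho> m K D \<theta> \<longleftrightarrow>
     (\<forall>j. D j \<in> X_space \<rho> m) \<and>
     ((\<lambda>h. X_norm \<rho> m (\<lambda>x. K (\<theta> + h) x - K \<theta> x - lin_map D h x) / norm h) \<longlongrightarrow> 0) (at 0)"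

text \<open>
  An analytic injective immersion of the torus, with derivative \<open>DK\<close>. Since the torus is compact,
  it is automatically a homeomorphism onto its image.
\<close>
definition analytic_torus_embedding ::
  "real \<Rightarrow> nat \<Rightarrow> (real ^ 'l::finite \<Rightarrow> state) \<Rightarrow> (real ^ 'l \<Rightarrow> 'l \<Rightarrow> state) \<Rightarrow> bool" where
  "analytic_torus_embedding \<rho> m K DK \<longleftrightarrow>
     (\<forall>\<theta>. K \<theta> \<in> X_space \<rho> m) \<and>
     (\<forall>\<theta> \<theta>'. K \<theta> = K \<theta>' \<longleftrightarrow> (\<forall>i. \<theta> $ i - \<theta>' $ i \<in> \<int>)) \<and>
     X_analytic \<rho> m K \<and>
     (\<forall>\<theta>. has_X_derivative \<rho> m K (DK \<theta>) \<theta>) \<and>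
     (\<forall>\<theta> h. lin_map (DK \<theta>) h = (\<lambda>x. 0) \<longrightarrow> h = 0)"

definition invariance_equation ::
  "real \<Rightarrow> real \<Rightarrow> (real ^ 'l::finite \<Rightarrow> state) \<Rightarrow> (real ^ 'l \<Rightarrow> 'l \<Rightarrow> state) \<Rightarrow> real ^ 'l \<Rightarrow> bool" where
  "invariance_equation \<rho> \<mu> K DK \<omega> \<longleftrightarrow>
     (\<forall>\<theta>. \<forall>x\<in>strip \<rho>. boussinesq \<mu> (K \<theta>) x = lin_map (DK \<theta>) \<omega> x)"

end

theory Submission
  imports Defs
begin

text \<open>
  For \<open>\<ell> = 1\<close> the invariant circles can be written down: they are orbits of travelling waves
  \<open>K \<theta> x = (U, V) (x + \<theta>)\<close>. The second equation gives \<open>U = d - \<omega> V\<close>, and the first becomes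
  \<open>\<mu> V'' + \<alpha> V + \<omega> V\<^sup>2 = const\<close> with \<open>\<alpha> = 1 - d - \<omega>\<^sup>2\<close>, where \<open>d\<close> and hence \<open>\<alpha>\<close> is free. It is solved
  by an elliptic function with Fourier coefficients \<open>A n / sinh (n s)\<close>, \<open>A = 12 \<pi>\<^sup>2 \<mu> / \<omega>\<close>, because
  \<open>1 / (sinh a sinh b) = (coth a + coth b) / sinh (a + b)\<close> turns the convolution square of the
  coefficients \<open>n / sinh (n s)\<close> into a quadratic polynomial in \<open>n\<close> times these coefficients.
  Taking \<open>s > 2 \<pi> \<rho>\<close> makes the wave analytic beyond the strip. So every \<open>\<omega> \<noteq> 0\<close> is the frequency of
  such a circle, and a one-dimensional Diophantine set is the complement of an interval around \<open>0\<close>,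
  whose radius \<open>1 / b_d\<close> only has to be small compared to \<open>a\<close>.
\<close>

subsection \<open>The convolution identity for \<open>n / sinh (n s)\<close>\<close>

lemma exp_abs_int_summable:
  assumes "\<delta> > 0"
  shows "(\<lambda>n::int. exp (- (\<delta> * \<bar>real_of_int n\<bar>))) summable_on UNIV"
proof -
  let ?f = "\<lambda>n::int. exp (- (\<delta> * \<bar>real_of_int n\<bar>))"
  have g: "(\<lambda>n::nat. exp (- \<delta>) ^ n) summable_on UNIV"
    using assms by (intro summable_nonneg_imp_summable_on summable_geometric) auto
  have e: "exp (- (\<delta> * real n)) = exp (- \<delta>) ^ n" for n
    by (simp add: exp_of_nat_mult[symmetric] mult.commute)
  have 1: "?f summable_on range int"
    by (subst summable_on_reindex) (use g in \<open>auto simp: o_def e\<close>)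
  have 2: "?f summable_on range (\<lambda>n. - int n)"
    by (subst summable_on_reindex) (use g in \<open>auto simp: o_def e inj_on_def\<close>)
  have "range int \<union> range (\<lambda>n. - int n) = UNIV"
    by (auto simp: image_iff) (metis int_cases2)
  with summable_on_union[OF 1 2] show ?thesis by simp
qed

text \<open>A single term of the exponential series is at most its sum. Every polynomial weight
  below is paid for by this bound, at the price of a small part \<open>\<delta>\<close> of the
  exponential rate.\<close>

lemma power_le_exp:
  fixes x \<delta> :: real
  assumes "\<delta> > 0" "x \<ge> 0"
  shows "x ^ p \<le> fact p / \<delta> ^ p * exp (\<delta> * x)"
proof -
  have "(\<Sum>n\<in>{p}. (\<delta> * x) ^ n /\<^sub>R fact n) \<le> (\<Sum>n. (\<delta> * x) ^ n /\<^sub>R fact n)"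
    by (rule sum_le_suminf) (use assms summable_exp_generic[of "\<delta> * x"] in auto)
  then have "(\<delta> * x) ^ p / fact p \<le> exp (\<delta> * x)"
    by (simp add: exp_def divide_inverse mult.commute)
  then show ?thesis using assms by (simp add: field_simps power_mult_distrib)
qed

lemma power_exp_abs_int_summable:
  assumes "\<delta> > 0"
  shows "(\<lambda>n::int. \<bar>of_int n\<bar> ^ p * exp (- (\<delta> * \<bar>of_int n\<bar>)) :: real) summable_on UNIV"
proof (rule summable_on_comparison_test)
  \<comment> \<open>One half of the rate \<delta> absorbs the power, the other half remains for the
    summation.\<close>
  show "(\<lambda>n::int. fact p / (\<delta>/2) ^ p * exp (- (\<delta>/2 * \<bar>of_int n\<bar>))) summable_on UNIV"
    by (intro summable_on_cmult_right exp_abs_int_summable) (use assms in auto)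
  fix n :: int
  have "\<bar>of_int n\<bar> ^ p * exp (- (\<delta> * \<bar>of_int n\<bar>))
        \<le> (fact p / (\<delta>/2) ^ p * exp (\<delta>/2 * \<bar>of_int n\<bar>)) * exp (- (\<delta> * \<bar>of_int n\<bar>))"
    by (intro mult_right_mono power_le_exp) (use assms in auto)
  also have "\<dots> = fact p / (\<delta>/2) ^ p * exp (- (\<delta>/2 * \<bar>of_int n\<bar>))"
    by (simp add: mult.assoc exp_add[symmetric] del: times_divide_eq_left)
  finally show "\<bar>of_int n\<bar> ^ p * exp (- (\<delta> * \<bar>of_int n\<bar>))
     \<le> fact p / (\<delta>/2) ^ p * exp (- (\<delta>/2 * \<bar>of_int n\<bar>))" .
qed auto

text \<open>At \<open>n = 0\<close> the value is \<open>0\<close>, since HOL's division by \<open>sinh 0 = 0\<close> gives \<open>0\<close>.\<close>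
definition csch_coeff :: "real \<Rightarrow> int \<Rightarrow> real" where
  "csch_coeff s n = of_int n / sinh (of_int n * s)"

text \<open>The distance of \<open>coth (n s)\<close> from its limit at the end of the line to which
  \<open>n\<close> points. At \<open>n = 0\<close> both parts are 0, since division by
  \<open>sinh 0\<close> gives 0.\<close>

definition coth_defect :: "real \<Rightarrow> int \<Rightarrow> real" where
  "coth_defect s n =
     cosh (of_int n * s) / sinh (of_int n * s) - sgn (of_int n)"

text \<open>Expanding coth as a geometric series shows that, for positive \<open>s\<close>, this is
  4 times the sum of sigma(n) q^n with q = exp (-2 s), sigma the divisor sum. Hence
  \<open>1 - 6 * coth_moment s\<close>, which occurs in the wave equation below, is the Eisenstein
  series E_2.\<close>

definition coth_moment :: "real \<Rightarrow> real" where
  "coth_moment s = (\<Sum>\<^sub>\<infinity>n. of_int n * coth_defect s n)"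

text \<open>With t = s |n|, sinh t = exp t (1 - exp (-2 t)) / 2. Since |n| is at least 1, the
  bracket is smallest at t = s, which gives the constant.\<close>

lemma inverse_sinh_le:
  fixes s :: real and n :: int
  assumes "s > 0" "n \<noteq> 0"
  shows "1 / \<bar>sinh (of_int n * s)\<bar> \<le> 2 / (1 - exp (- 2 * s)) * exp (- (s * \<bar>of_int n\<bar>))"
proof -
  define t where "t = s * \<bar>real_of_int n\<bar>"
  have "t \<ge> s * 1" unfolding t_def by (intro mult_left_mono) (use assms in auto)
  then have t: "t \<ge> s" by simp
  have "\<bar>of_int n * s\<bar> = t"
    using assms by (simp add: t_def abs_mult)
  then have sh: "\<bar>sinh (of_int n * s)\<bar> = sinh t"
    using t assms(1) by (smt (verit) sinh_minus sinh_real_nonneg_iff)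
  have "sinh t = exp t * (1 - exp (-2 * t)) / 2"
    by (simp add: sinh_def algebra_simps exp_add[symmetric])
  also have "\<dots> \<ge> exp t * (1 - exp (-2 * s)) / 2"
    using t by (intro divide_right_mono mult_left_mono) auto
  finally have *: "sinh t \<ge> exp t * (1 - exp (-2 * s)) / 2" .
  have "1 / sinh t \<le> 1 / (exp t * (1 - exp (-2 * s)) / 2)"
    by (rule divide_left_mono[OF *]) (use assms t in \<open>auto intro!: mult_pos_pos\<close>)
  also have "\<dots> = 2 / (1 - exp (-2 * s)) * exp (- t)"
    by (simp add: exp_minus field_simps)
  finally show ?thesis by (simp add: sh t_def)
qed

text \<open>Over the common denominator the numerator is exactly exp (- s |n|) in modulus. Bounding
  it by 1 leaves the decay of 1 / sinh, which is enough for the moments.\<close>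

lemma coth_defect_le:
  assumes "s > 0"
  shows "\<bar>coth_defect s n\<bar> \<le> 2 / (1 - exp (- 2 * s)) * exp (- (s * \<bar>of_int n\<bar>))"
proof (cases "n = 0")
  case True
  then show ?thesis using assms by (simp add: coth_defect_def)
next
  case False
  have sh: "sinh (of_int n * s) \<noteq> 0" using False assms by simp
  have "\<bar>cosh (of_int n * s) - sgn (of_int n) * sinh (of_int n * s)\<bar> = exp (- (s * \<bar>of_int n\<bar>))"
    using False by (cases "n > 0") (auto simp: cosh_def sinh_def sgn_if abs_if field_simps)
  moreover have "coth_defect s n =
      (cosh (of_int n * s) - sgn (of_int n) * sinh (of_int n * s)) / sinh (of_int n * s)"
    unfolding coth_defect_def diff_divide_distrib using sh by simp
  ultimately have "\<bar>coth_defect s n\<bar> = exp (- (s * \<bar>of_int n\<bar>)) * (1 / \<bar>sinh (of_int n * s)\<bar>)"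
    by (simp add: abs_divide)
  also have "\<dots> \<le> 1 * (1 / \<bar>sinh (of_int n * s)\<bar>)"
    by (intro mult_right_mono) (use assms in auto)
  finally show ?thesis using inverse_sinh_le[OF assms False] by simp
qed

lemma coth_defect_moment_summable:
  assumes "s > 0"
  shows "(\<lambda>n. of_int n ^ p * coth_defect s n) summable_on UNIV"
proof (rule abs_summable_summable, rule summable_on_comparison_test)
  let ?c = "2 / (1 - exp (- 2 * s))"
  show "(\<lambda>n::int. ?c * (\<bar>of_int n\<bar> ^ p * exp (- (s * \<bar>of_int n\<bar>)))) summable_on UNIV"
    by (intro summable_on_cmult_right power_exp_abs_int_summable assms)
  fix n :: int
  show "norm (of_int n ^ p * coth_defect s n) \<le> ?c * (\<bar>of_int n\<bar> ^ p * exp (- (s * \<bar>of_int n\<bar>)))"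
    using mult_left_mono[OF coth_defect_le[OF assms, of n], of "\<bar>of_int n\<bar> ^ p"]
    by (simp add: abs_mult power_abs mult_ac)
qed auto

lemma csch_coeff_le:
  assumes "s > 0"
  shows "\<bar>csch_coeff s n\<bar> \<le> 2 / (1 - exp (- 2 * s)) * (\<bar>of_int n\<bar> * exp (- (s * \<bar>of_int n\<bar>)))"
proof (cases "n = 0")
  case False
  from mult_left_mono[OF inverse_sinh_le[OF assms this], of "\<bar>of_int n\<bar>"] show ?thesis
    by (simp add: csch_coeff_def abs_divide mult_ac)
qed (simp add: csch_coeff_def)

lemma csch_coeff_minus [simp]: "csch_coeff s (- n) = csch_coeff s n"
  by (simp add: csch_coeff_def)

lemma csch_coeff_0 [simp]: "csch_coeff s 0 = 0"
  by (simp add: csch_coeff_def)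

lemma csch_coeff_nonzero: "s > 0 \<Longrightarrow> n \<noteq> 0 \<Longrightarrow> csch_coeff s n \<noteq> 0"
  by (simp add: csch_coeff_def)

text \<open>\<open>x\<close> is kept independent of \<open>N\<close>: with \<open>x = N\<close> all
  summands would change in the induction step. The case \<open>x = N\<close> is the one used for the
  sign part.\<close>

lemma sum_int_mult_diff:
  "(\<Sum>j\<in>{0..int N}. 2 * of_int j * (x - of_int j)) =
     x * real N * (real N + 1) - real N * (real N + 1) * (2 * real N + 1) / 3"
proof (induction N)
  case (Suc N)
  have "{0..int (Suc N)} = insert (int (Suc N)) {0..int N}" by auto
  then show ?case using Suc by (simp add: field_simps)
qed simp

text \<open>
  Write \<open>coth (j s) = sgn j + coth_defect s j\<close>. The sign part of the convolution is a finite sum,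
  the exponentially decaying rest can be split and shifted termwise.
\<close>
lemma sgn_convolution:
  assumes "n \<ge> 0"
  shows "((\<lambda>j::int. of_int j * of_int (n - j) * (sgn (of_int j) - sgn (of_int (j - n)))) has_sum
          ((of_int n ^ 3 - of_int n) / 3 :: real)) UNIV"
proof (rule has_sum_finite_neutralI)
  have "(\<Sum>j = 0..n. of_int j * of_int (n - j) * (sgn (of_int j) - sgn (of_int (j - n)))) =
        (\<Sum>j\<in>{0..int (nat n)}. 2 * of_int j * (of_int n - of_int j) :: real)"
    using assms by (intro sum.cong) (auto simp: sgn_if)
  also have "\<dots> = (of_int n ^ 3 - of_int n) / 3"
    unfolding sum_int_mult_diff using assms by (simp add: field_simps power3_eq_cube)
  finally show "(of_int n ^ 3 - of_int n) / 3 = (\<Sum>j = 0..n. of_int j * of_int (n - j) *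
       (sgn (of_int j) - sgn (of_int (j - n))) :: real)" by simp
  show "of_int j * of_int (n - j) * (sgn (of_int j) - sgn (of_int (j - n))) = (0::real)"
    if "j \<in> UNIV - {0..n}" for j :: int
    using that assms by (auto simp: sgn_if)
qed auto

text \<open>The sum is split at the difference, and the second half is shifted by \<open>n\<close>.
  The two halves become n M - Q and n M + Q with M the first and Q the second moment, so the second
  moment cancels. The splitting is legitimate because all moments converge absolutely.\<close>

lemma defect_convolution:
  assumes "s > 0"
  shows "((\<lambda>j::int. of_int j * of_int (n - j) * (coth_defect s j - coth_defect s (j - n))) has_sum
          (2 * of_int n * coth_moment s)) UNIV"
proof -
  define Q where "Q = (\<Sum>\<^sub>\<infinity>n. of_int n ^ 2 * coth_defect s n)"
  have M: "((\<lambda>j. of_int j * coth_defect s j) has_sum coth_moment s) UNIV"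
    using coth_defect_moment_summable[OF assms, of 1] by (simp add: coth_moment_def)
  have Q: "((\<lambda>j. of_int j ^ 2 * coth_defect s j) has_sum Q) UNIV"
    using coth_defect_moment_summable[OF assms, of 2] by (simp add: Q_def)
  have nM: "((\<lambda>j. of_int n * (of_int j * coth_defect s j)) has_sum of_int n * coth_moment s) UNIV"
    by (rule has_sum_cmult_right[OF M])
  have 1: "((\<lambda>j. of_int j * of_int (n - j) * coth_defect s j) has_sum (of_int n * coth_moment s + - Q)) UNIV"
    by (rule has_sum_cong[THEN iffD1, OF _ has_sum_add[OF nM has_sum_uminusI[OF Q]]])
       (simp add: algebra_simps power2_eq_square)
  have 2: "((\<lambda>j. (of_int j + of_int n) * of_int j * coth_defect s j) has_sum (of_int n * coth_moment s + Q)) UNIV"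
    by (rule has_sum_cong[THEN iffD1, OF _ has_sum_add[OF nM Q]])
       (simp add: algebra_simps power2_eq_square)
  have 3: "((\<lambda>j. - (of_int j * of_int (n - j)) * coth_defect s (j - n)) has_sum (of_int n * coth_moment s + Q)) UNIV"
    by (rule has_sum_reindex_bij_witness[where i = "\<lambda>j. j + n" and j = "\<lambda>j. j - n", THEN iffD2, OF _ _ _ _ _ _ 2])
       (auto simp: algebra_simps)
  have "of_int n * coth_moment s + - Q + (of_int n * coth_moment s + Q) = 2 * of_int n * coth_moment s"
    by simp
  with has_sum_add[OF 1 3] show ?thesis
    by (simp add: algebra_simps)
qed

text \<open>The addition formula of sinh takes the factor 1 / sinh (n s) out of the convolution;
  what is left is the sign part plus the defect part. Both contain a factor \<open>n\<close>, which
  recombines with 1 / sinh (n s) to the coefficient itself. Negative \<open>n\<close> follow by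
  reflecting \<open>j\<close>, as the coefficients are even.\<close>

lemma csch_convolution:
  assumes "s > 0" "n \<noteq> 0"
  shows "((\<lambda>j. csch_coeff s j * csch_coeff s (n - j)) has_sum
          (csch_coeff s n * ((of_int n ^ 2 - 1) / 3 + 2 * coth_moment s))) UNIV"
proof -
  have pos: "((\<lambda>j. csch_coeff s j * csch_coeff s (n - j)) has_sum
          (csch_coeff s n * ((of_int n ^ 2 - 1) / 3 + 2 * coth_moment s))) UNIV" if "n > 0" for n
  proof -
    have n: "sinh (of_int n * s) \<noteq> 0" using that assms by simp
    have term_eq: "csch_coeff s j * csch_coeff s (n - j) =
        1 / sinh (of_int n * s) *
          (of_int j * of_int (n - j) * (sgn (of_int j) - sgn (of_int (j - n))) +
           of_int j * of_int (n - j) * (coth_defect s j - coth_defect s (j - n)))" for j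
    \<comment> \<open>The addition formula needs both sinh values to be nonzero. In the two
      exceptional cases both sides vanish: the left by the default value at index 0, the right by
      the factor \<open>j * (n - j)\<close>.\<close>
    proof (cases "j = 0 \<or> j = n")
      case False
      define A B where "A = of_int j * s" and "B = of_int (n - j) * s"
      have AB: "sinh A \<noteq> 0" "sinh B \<noteq> 0" using False assms by (auto simp: A_def B_def)
      have nAB: "of_int n * s = A + B" "of_int (j - n) * s = - B"
        by (simp_all add: A_def B_def algebra_simps)
      \<comment> \<open>The signs cancel, and coth is odd, so the difference of its values at
        \<open>j\<close> and \<open>j - n\<close> is the sum coth A + coth B.\<close>
      have "sgn (of_int j) - sgn (of_int (j - n)) + (coth_defect s j - coth_defect s (j - n)) =
            cosh A / sinh A + cosh B / sinh B"
        unfolding coth_defect_def nAB A_def[symmetric] by simp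
      also have "\<dots> = sinh (A + B) / (sinh A * sinh B)"
        using AB by (simp add: sinh_add field_simps)
      finally have "1 / sinh (A + B) * (of_int j * of_int (n - j) * (sgn (of_int j) - sgn (of_int (j - n)) + (coth_defect s j - coth_defect s (j - n)))) =
        of_int j * of_int (n - j) / (sinh A * sinh B)"
        using n unfolding nAB by simp
      then show ?thesis
        unfolding nAB csch_coeff_def A_def[symmetric] B_def[symmetric] distrib_left[symmetric] by simp
    qed auto
    have "((\<lambda>j. csch_coeff s j * csch_coeff s (n - j)) has_sum (1 / sinh (of_int n * s) *
            ((of_int n ^ 3 - of_int n) / 3 + 2 * of_int n * coth_moment s))) UNIV"
      unfolding term_eq using that assms
      by (intro has_sum_cmult_right has_sum_add sgn_convolution defect_convolution) auto
    also have "1 / sinh (of_int n * s) * ((of_int n ^ 3 - of_int n) / 3 + 2 * of_int n * coth_moment s) =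
        csch_coeff s n * ((of_int n ^ 2 - 1) / 3 + 2 * coth_moment s)"
      by (simp add: csch_coeff_def power3_eq_cube power2_eq_square algebra_simps diff_divide_distrib add_divide_distrib)
    finally show ?thesis .
  qed
  show ?thesis
  proof (cases "n > 0")
    case False
    with assms have "- n > 0" by simp
    from pos[OF this] show ?thesis
      by (subst has_sum_reindex_bij_witness[where i = uminus and j = uminus and T = UNIV
            and h = "\<lambda>j. csch_coeff s j * csch_coeff s (- n - j)"])
         (auto, metis add.commute csch_coeff_minus minus_diff_eq uminus_add_conv_diff)
  qed (rule pos)
qed

subsection \<open>Fourier series on a strip\<close>

definition mode :: "int \<Rightarrow> complex \<Rightarrow> complex" where
  "mode n x = exp (of_real (2 * pi * of_int n) * \<i> * x)"

text \<open>A weighted l^1 condition replaces the weighted l^2 norm of H: it gives absolute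
  convergence wherever 2 pi |Im x| is at most \<sigma>, so that products and Taylor expansions are
  rearrangements of absolutely summable families. A rate \<sigma> above 2 pi \<rho> is sufficient
  for membership in H.\<close>

definition wsummable :: "real \<Rightarrow> (int \<Rightarrow> complex) \<Rightarrow> bool" where
  "wsummable \<sigma> f \<longleftrightarrow> (\<lambda>n. norm (f n) * exp (\<sigma> * \<bar>of_int n\<bar>)) summable_on UNIV"

definition wnorm :: "real \<Rightarrow> (int \<Rightarrow> complex) \<Rightarrow> real" where
  "wnorm \<sigma> f = (\<Sum>\<^sub>\<infinity>n. norm (f n) * exp (\<sigma> * \<bar>of_int n\<bar>))"

definition fourier_series :: "(int \<Rightarrow> complex) \<Rightarrow> complex \<Rightarrow> complex" where
  "fourier_series f x = (\<Sum>\<^sub>\<infinity>n. f n * mode n x)"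

text \<open>The value 0 outside the strip follows the convention of \<open>H_space\<close>, under
  which elements are equal exactly when they are equal as functions.\<close>

definition strip_series :: "real \<Rightarrow> (int \<Rightarrow> complex) \<Rightarrow> complex \<Rightarrow> complex" where
  "strip_series \<rho> f x = (if x \<in> strip \<rho> then fourier_series f x else 0)"

definition diff_coeff :: "(int \<Rightarrow> complex) \<Rightarrow> int \<Rightarrow> complex" where
  "diff_coeff f n = of_real (2 * pi * of_int n) * \<i> * f n"

lemma mode_add: "mode n (x + y) = mode n x * mode n y"
  by (simp add: mode_def distrib_left exp_add)

lemma mode_0 [simp]: "mode n 0 = 1" "mode 0 x = 1"
  by (simp_all add: mode_def)

lemma mode_add_index: "mode (j + n) x = mode j x * mode n x"
  by (simp add: mode_def algebra_simps exp_add)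

lemma mode_of_int [simp]: "mode n (of_int k) = 1"
  using exp_integer_2pi[of "of_int (n * k)"] by (simp add: mode_def mult_ac)

lemma norm_mode: "norm (mode n x) = exp (- (2 * pi * of_int n * Im x))"
  by (simp add: mode_def)

lemma norm_mode_of_real [simp]: "norm (mode n (of_real t)) = 1"
  by (simp add: norm_mode)

lemma norm_mode_le: "norm (mode n x) \<le> exp (2 * pi * \<bar>Im x\<bar> * \<bar>of_int n\<bar>)"
proof -
  have "- (of_int n * Im x) \<le> \<bar>Im x\<bar> * \<bar>real_of_int n\<bar>"
    by (metis abs_ge_minus_self abs_mult mult.commute)
  then have "2 * pi * - (of_int n * Im x) \<le> 2 * pi * (\<bar>Im x\<bar> * \<bar>real_of_int n\<bar>)"
    by (intro mult_left_mono) auto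
  then show ?thesis by (simp add: norm_mode mult_ac)
qed

lemma wsummable_le:
  assumes "wsummable \<sigma>' g"
    "\<And>n. norm (f n) * exp (\<sigma> * \<bar>of_int n\<bar>) \<le> C * (norm (g n) * exp (\<sigma>' * \<bar>of_int n\<bar>))"
  shows "wsummable \<sigma> f"
  unfolding wsummable_def
  by (rule summable_on_comparison_test[OF summable_on_cmult_right[OF assms(1)[unfolded wsummable_def], of C]])
     (use assms(2) in auto)

lemma wnorm_has_sum:
  "wsummable \<sigma> f \<Longrightarrow> ((\<lambda>n. norm (f n) * exp (\<sigma> * \<bar>of_int n\<bar>)) has_sum wnorm \<sigma> f) UNIV"
  by (simp add: wsummable_def wnorm_def)

lemma wnorm_nonneg: "wnorm \<sigma> f \<ge> 0"
  unfolding wnorm_def by (intro infsum_nonneg) auto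

lemma wsummable_mono:
  assumes "wsummable \<sigma>' f" "\<sigma> \<le> \<sigma>'"
  shows "wsummable \<sigma> f"
  by (rule wsummable_le[OF assms(1), where C = 1])
     (use assms(2) in \<open>auto intro!: mult_left_mono mult_right_mono\<close>)

text \<open>Any strict loss of rate pays for a power of \<open>n\<close>, hence for any number of
  derivatives.\<close>

lemma wsummable_power_mult:
  assumes "wsummable \<sigma>' f" "\<sigma> < \<sigma>'"
  shows "wsummable \<sigma> (\<lambda>n. of_int n ^ p * f n)"
proof (rule wsummable_le[OF assms(1), where C = "fact p / (\<sigma>' - \<sigma>) ^ p"])
  fix n :: int
  have "\<bar>real_of_int n\<bar> ^ p \<le> fact p / (\<sigma>' - \<sigma>) ^ p * exp ((\<sigma>' - \<sigma>) * \<bar>of_int n\<bar>)"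
    by (rule power_le_exp) (use assms in auto)
  then have "\<bar>real_of_int n\<bar> ^ p * (norm (f n) * exp (\<sigma> * \<bar>of_int n\<bar>)) \<le>
      fact p / (\<sigma>' - \<sigma>) ^ p * exp ((\<sigma>' - \<sigma>) * \<bar>of_int n\<bar>) * (norm (f n) * exp (\<sigma> * \<bar>of_int n\<bar>))"
    by (rule mult_right_mono) auto
  also have "\<dots> = fact p / (\<sigma>' - \<sigma>) ^ p * (norm (f n) * exp (\<sigma>' * \<bar>of_int n\<bar>))"
    by (simp add: left_diff_distrib exp_diff)
  finally show "norm (of_int n ^ p * f n) * exp (\<sigma> * \<bar>of_int n\<bar>) \<le>
      fact p / (\<sigma>' - \<sigma>) ^ p * (norm (f n) * exp (\<sigma>' * \<bar>of_int n\<bar>))"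
    by (simp add: norm_mult norm_power mult_ac)
qed

lemma wsummable_cmult: "wsummable \<sigma> f \<Longrightarrow> wsummable \<sigma> (\<lambda>n. c * f n)"
  by (erule wsummable_le[where C = "norm c"]) (simp add: norm_mult)

lemma wsummable_add:
  assumes "wsummable \<sigma> f" "wsummable \<sigma> g"
  shows "wsummable \<sigma> (\<lambda>n. f n + g n)"
  unfolding wsummable_def
proof (rule summable_on_comparison_test)
  show "(\<lambda>n. norm (f n) * exp (\<sigma> * \<bar>of_int n\<bar>) + norm (g n) * exp (\<sigma> * \<bar>of_int n\<bar>)) summable_on UNIV"
    using assms unfolding wsummable_def by (rule summable_on_add)
qed (auto simp: distrib_right[symmetric] norm_triangle_ineq)

lemma wsummable_finite:
  assumes "finite {n. f n \<noteq> 0}"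
  shows "wsummable \<sigma> f"
  unfolding wsummable_def
  by (rule finite_nonzero_values_imp_summable_on) (use assms in auto)

lemma wsummable_diff_coeff:
  assumes "wsummable \<sigma>' f" "\<sigma> < \<sigma>'"
  shows "wsummable \<sigma> (diff_coeff f)"
  using wsummable_cmult[OF wsummable_power_mult[OF assms, of 1], of "of_real (2 * pi) * \<i>"]
  by (simp add: diff_coeff_def[abs_def] mult_ac)

lemma wsummable_imp_term_le:
  assumes "wsummable \<sigma> f"
  shows "norm (f n) * exp (\<sigma> * \<bar>of_int n\<bar>) \<le> wnorm \<sigma> f"
  using finite_sum_le_has_sum[OF wnorm_has_sum[OF assms], of "{n}"] by simp

lemma fourier_series_abs_summable:
  assumes "wsummable \<sigma> f" "2 * pi * \<bar>Im x\<bar> \<le> \<sigma>"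
  shows "(\<lambda>n. norm (f n * mode n x)) summable_on UNIV"
  unfolding norm_mult
proof (rule summable_on_comparison_test[OF assms(1)[unfolded wsummable_def]])
  fix n
  have "norm (mode n x) \<le> exp (2 * pi * \<bar>Im x\<bar> * \<bar>of_int n\<bar>)" by (rule norm_mode_le)
  also have "\<dots> \<le> exp (\<sigma> * \<bar>of_int n\<bar>)" using assms(2) by (auto intro: mult_right_mono)
  finally show "norm (f n) * norm (mode n x) \<le> norm (f n) * exp (\<sigma> * \<bar>of_int n\<bar>)"
    by (rule mult_left_mono) auto
qed auto

lemma fourier_series_has_sum:
  assumes "wsummable \<sigma> f" "2 * pi * \<bar>Im x\<bar> \<le> \<sigma>"
  shows "((\<lambda>n. f n * mode n x) has_sum fourier_series f x) UNIV"
  using abs_summable_summable[OF fourier_series_abs_summable[OF assms]]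
  by (simp add: fourier_series_def)

lemma DERIV_of_quadratic_bound:
  fixes f :: "complex \<Rightarrow> complex"
  assumes "\<delta> > 0" "\<And>h. norm h < \<delta> \<Longrightarrow> norm (f (x + h) - f x - h * D) \<le> C * norm h ^ 2"
  shows "(f has_field_derivative D) (at x)"
proof -
  have "((\<lambda>h. (f (x + h) - f x) / h - D) \<longlongrightarrow> 0) (at 0)"
  proof (rule Lim_null_comparison)
    show "\<forall>\<^sub>F h in at 0. norm ((f (x + h) - f x) / h - D) \<le> C * norm h"
      unfolding eventually_at
    proof (intro exI[of _ \<delta>] conjI ballI impI)
      fix h :: complex assume h: "h \<noteq> 0 \<and> dist h 0 < \<delta>"
      have "(f (x + h) - f x) / h - D = (f (x + h) - f x - h * D) / h"
        using h by (simp add: field_simps)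
      also have "norm \<dots> \<le> (C * norm h ^ 2) / norm h"
        unfolding norm_divide using h by (intro divide_right_mono assms) auto
      finally show "norm ((f (x + h) - f x) / h - D) \<le> C * norm h"
        using h by (simp add: power2_eq_square)
    qed (use assms in auto)
    show "((\<lambda>h::complex. C * norm h) \<longlongrightarrow> 0) (at 0)"
      by (intro tendsto_mult_right_zero tendsto_norm_zero tendsto_ident_at)
  qed
  then show ?thesis unfolding DERIV_def by (simp add: LIM_zero_iff)
qed

lemma norm_exp_remainder_le: "norm (exp z - 1 - z) \<le> exp (norm z) * norm (z :: complex) ^ 2"
  using Taylor_exp_field[of z 1] by (simp add: power2_eq_square numeral_2_eq_2 algebra_simps)

lemma has_sum_diff:
  fixes f g :: "'a \<Rightarrow> 'b :: real_normed_vector"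
  assumes "(f has_sum a) A" "(g has_sum b) A"
  shows "((\<lambda>x. f x - g x) has_sum (a - b)) A"
  using has_sum_add[OF assms(1), of "\<lambda>x. - g x" "- b"] assms(2) by (simp add: has_sum_uminus)

text \<open>Termwise, the remainder of first order is \<open>exp v - 1 - v\<close> with v = 2 pi i n
  h, which is quadratic in \<open>n h\<close>. The factor n^2 is paid for by a rate
  \<open>\<tau>\<close> strictly below \<open>\<sigma>\<close>.\<close>

lemma fourier_series_deriv:
  assumes "wsummable \<sigma> f" "2 * pi * \<bar>Im x\<bar> < \<sigma>"
  shows "(fourier_series f has_field_derivative fourier_series (diff_coeff f) x) (at x)"
proof (rule DERIV_of_quadratic_bound)
  \<comment> \<open>Chosen so that \<open>\<tau>\<close> below is the midpoint of
    \<open>2 * pi * \<bar>Im x\<bar>\<close> and \<open>\<sigma>\<close>: displacements up to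
    \<delta> stay within rate \<tau>, and a gap to \<sigma> remains.\<close>
  define \<delta> where "\<delta> = (\<sigma> - 2 * pi * \<bar>Im x\<bar>) / (4 * pi)"
  show "\<delta> > 0" using assms by (simp add: \<delta>_def)
  define \<tau> where "\<tau> = 2 * pi * \<bar>Im x\<bar> + 2 * pi * \<delta>"
  have "2 * pi * \<delta> = (\<sigma> - 2 * pi * \<bar>Im x\<bar>) / 2" by (simp add: \<delta>_def)
  then have \<tau>: "\<tau> < \<sigma>" using assms(2) by (simp add: \<tau>_def)
  let ?g = "\<lambda>n. of_int n ^ 2 * f n"
  have sg: "wsummable \<tau> ?g" by (rule wsummable_power_mult[OF assms(1) \<tau>])
  fix h :: complex assume h: "norm h < \<delta>"
  have *: "2 * pi * \<bar>Im (x + h)\<bar> \<le> \<tau>"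
    using h abs_Im_le_cmod[of h] by (simp add: \<tau>_def distrib_left[symmetric])
  have \<tau>0: "2 * pi * \<bar>Im x\<bar> \<le> \<tau>" using \<open>\<delta> > 0\<close> by (simp add: \<tau>_def)
  note f\<tau> = wsummable_mono[OF assms(1) less_imp_le[OF \<tau>]]
  have sum: "((\<lambda>n. f n * mode n (x + h) - f n * mode n x - h * (diff_coeff f n * mode n x)) has_sum
     (fourier_series f (x + h) - fourier_series f x - h * fourier_series (diff_coeff f) x)) UNIV"
    by (intro has_sum_diff has_sum_cmult_right fourier_series_has_sum[OF f\<tau>]
        fourier_series_has_sum[OF wsummable_diff_coeff[OF assms(1) \<tau>]] * \<tau>0)
  have "norm (fourier_series f (x + h) - fourier_series f x - h * fourier_series (diff_coeff f) x)
    \<le> (4 * pi\<^sup>2 * norm h ^ 2) * wnorm \<tau> ?g"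
  proof (rule norm_infsum_le[OF sum has_sum_cmult_right[OF wnorm_has_sum[OF sg]]])
    fix n :: int
    define v where "v = of_real (2 * pi * of_int n) * \<i> * h"
    have nv: "norm v = 2 * pi * \<bar>of_int n\<bar> * norm h" by (simp add: v_def norm_mult)
    have "f n * mode n (x + h) - f n * mode n x - h * (diff_coeff f n * mode n x) =
      f n * mode n x * (exp v - 1 - v)"
      by (simp add: mode_add diff_coeff_def algebra_simps v_def) (simp add: mode_def mult_ac)
    also have "norm \<dots> \<le> norm (f n) * exp (2 * pi * \<bar>Im x\<bar> * \<bar>of_int n\<bar>) * (exp (norm v) * norm v ^ 2)"
      unfolding norm_mult by (intro mult_mono norm_mode_le norm_exp_remainder_le) auto
    \<comment> \<open>Since \<open>h\<close> is shorter than \<delta>, the exponential in the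
      remainder raises the weight at \<open>x\<close> at most to the weight of rate \<tau>.\<close>
    also have "\<dots> \<le> norm (f n) * exp (2 * pi * \<bar>Im x\<bar> * \<bar>of_int n\<bar>) * (exp (2 * pi * \<bar>of_int n\<bar> * \<delta>) * norm v ^ 2)"
      using h by (intro mult_left_mono mult_right_mono) (auto simp: nv intro!: mult_left_mono)
    also have "\<dots> = norm (f n) * exp (\<tau> * \<bar>of_int n\<bar>) * norm v ^ 2"
      by (simp add: \<tau>_def distrib_left distrib_right exp_add mult_ac)
    also have "\<dots> = 4 * pi\<^sup>2 * (cmod h)\<^sup>2 * (cmod (of_int n ^ 2 * f n) * exp (\<tau> * \<bar>of_int n\<bar>))"
      by (simp add: nv norm_mult norm_power power_mult_distrib mult_ac)
    finally show "norm (f n * mode n (x + h) - f n * mode n x - h * (diff_coeff f n * mode n x)) \<le>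
       4 * pi\<^sup>2 * (cmod h)\<^sup>2 * (cmod (of_int n ^ 2 * f n) * exp (\<tau> * \<bar>of_int n\<bar>))" .
  qed
  then show "norm (fourier_series f (x + h) - fourier_series f x - h * fourier_series (diff_coeff f) x)
    \<le> (4 * pi\<^sup>2 * wnorm \<tau> ?g) * norm h ^ 2"
    by (simp add: mult_ac)
qed

lemma mode_integral:
  "((\<lambda>x. mode n (of_real x)) has_integral (if n = 0 then 1 else 0)) {0..1}"
proof (cases "n = 0")
  case False
  define c where "c = complex_of_real (2 * pi * of_int n) * \<i>"
  have c: "c \<noteq> 0" using False by (simp add: c_def)
  have "((\<lambda>x. exp (c * of_real x)) has_integral (exp (c * of_real 1) / c - exp (c * of_real 0) / c)) {0..1}"
    by (rule fundamental_theorem_of_calculus)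
       (use c in \<open>auto intro!: derivative_eq_intros has_vector_derivative_real_field\<close>)
  moreover have "exp c = 1"
    using mode_of_int[of n 1] by (simp add: mode_def c_def)
  ultimately show ?thesis using False by (simp add: mode_def c_def)
qed (use has_integral_const_real[of "1::complex" 0 1] in simp)

text \<open>All modes have modulus 1 on the real axis, so the series converges uniformly there by
  the M-test and may be integrated termwise; orthogonality of the modes leaves one term.\<close>

lemma fourier_coeff_strip_series:
  assumes "wsummable \<sigma> f" "\<sigma> \<ge> 0" "\<rho> > 0"
  shows "fourier_coeff (strip_series \<rho> f) k = f k"
proof -
  have *: "strip_series \<rho> f (of_real x) * cis (- (2 * pi * of_int k * x)) =
           fourier_series f (of_real x) * mode (- k) (of_real x)" for x
    using assms(3) by (simp add: strip_series_def strip_def mode_def cis_conv_exp mult_ac)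
  let ?t = "\<lambda>n x. f n * mode (n - k) (complex_of_real x)"
  have "uniform_limit (cbox 0 1) (\<lambda>N x. \<Sum>n\<in>N. ?t n x)
      (\<lambda>x. fourier_series f (of_real x) * mode (- k) (of_real x)) (finite_subsets_at_top UNIV)"
  proof (rule Weierstrass_m_test_general')
    show "(\<lambda>n. norm (f n) * exp (0 * \<bar>of_int n\<bar>)) summable_on UNIV"
      using wsummable_mono[OF assms(1,2)] by (simp add: wsummable_def)
    show "norm (?t n x) \<le> norm (f n) * exp (0 * \<bar>of_int n\<bar>)" for n x
      by (simp add: norm_mult)
    show "((\<lambda>n. ?t n x) has_sum fourier_series f (of_real x) * mode (- k) (of_real x)) UNIV" for x
      using has_sum_cmult_left[OF fourier_series_has_sum[OF assms(1), of "of_real x"], of "mode (- k) (of_real x)"] assms(2)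
      by (simp add: mode_add_index[of _ "- k", simplified] mult_ac)
  qed
  then obtain I J where IJ: "\<And>N. ((\<lambda>x. \<Sum>n\<in>N. ?t n x) has_integral I N) (cbox 0 1)"
    "((\<lambda>x. fourier_series f (of_real x) * mode (- k) (of_real x)) has_integral J) (cbox 0 1)"
    "(I \<longlongrightarrow> J) (finite_subsets_at_top UNIV)"
    by (rule uniform_limit_integral_cbox)
       (auto intro!: continuous_intros simp: mode_def)
  \<comment> \<open>The integrals of the partial sums are constant as soon as the finite index set
    contains \<open>k\<close>, so their limit is known.\<close>
  have "I N = f k" if "finite N" "k \<in> N" for N
  proof -
    have "((\<lambda>x. \<Sum>n\<in>N. ?t n x) has_integral (\<Sum>n\<in>N. f n * (if n - k = 0 then 1 else 0))) {0..1}"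
      using that by (intro has_integral_sum has_integral_mult_right mode_integral)
    then have "I N = (\<Sum>n\<in>N. f n * (if n - k = 0 then 1 else 0))"
      using IJ(1)[of N] by (simp add: has_integral_unique)
    also have "\<dots> = (\<Sum>n\<in>N. if n = k then f n else 0)" by (intro sum.cong) auto
    finally show ?thesis using that by simp
  qed
  then have "\<forall>\<^sub>F N in finite_subsets_at_top UNIV. I N = f k"
    unfolding eventually_finite_subsets_at_top by (intro exI[of _ "{k}"]) auto
  then have "(I \<longlongrightarrow> f k) (finite_subsets_at_top UNIV)"
    by (rule tendsto_eventually)
  then have "J = f k" using IJ(3) tendsto_unique finite_subsets_at_top_neq_bot by blast
  with IJ(2) show ?thesis unfolding fourier_coeff_def * by (simp add: integral_unique)
qed

section \<open>Comparison of weighted l^1 sums with the norm of H\<close>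

lemma H_weight_le:
  assumes "2 * pi * \<rho> < \<sigma>"
  obtains C where "C \<ge> 0" "\<And>n::int. exp (4 * pi * \<rho> * \<bar>of_int n\<bar>) * (\<bar>of_int n\<bar> ^ (2 * m) + 1) \<le> C * exp (\<sigma> * \<bar>of_int n\<bar>) ^ 2"
proof
  \<comment> \<open>The weight of H belongs to squared coefficients, so it is compared with twice
    the rate \<sigma>; this surplus absorbs the power of degree \<open>2 * m\<close>.\<close>
  define \<delta> where "\<delta> = 2 * \<sigma> - 4 * pi * \<rho>"
  have \<delta>: "\<delta> > 0" using assms by (simp add: \<delta>_def)
  show "fact (2 * m) / \<delta> ^ (2 * m) + 1 \<ge> 0" using \<delta> by simp
  fix n :: int
  have "\<bar>real_of_int n\<bar> ^ (2 * m) + 1 \<le> fact (2 * m) / \<delta> ^ (2 * m) * exp (\<delta> * \<bar>of_int n\<bar>) + 1 * exp (\<delta> * \<bar>of_int n\<bar>)"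
    by (intro add_mono power_le_exp) (use \<delta> in auto)
  then have "exp (4 * pi * \<rho> * \<bar>of_int n\<bar>) * (\<bar>of_int n\<bar> ^ (2 * m) + 1) \<le>
     exp (4 * pi * \<rho> * \<bar>of_int n\<bar>) * ((fact (2 * m) / \<delta> ^ (2 * m) + 1) * exp (\<delta> * \<bar>of_int n\<bar>))"
    by (intro mult_left_mono) (auto simp: distrib_right)
  also have "\<dots> = (fact (2 * m) / \<delta> ^ (2 * m) + 1) * exp (4 * pi * \<rho> * \<bar>of_int n\<bar> + \<delta> * \<bar>of_int n\<bar>)"
    by (simp add: exp_add)
  also have "4 * pi * \<rho> * \<bar>real_of_int n\<bar> + \<delta> * \<bar>of_int n\<bar> = 2 * (\<sigma> * \<bar>of_int n\<bar>)"
    by (simp add: \<delta>_def algebra_simps)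
  finally show "exp (4 * pi * \<rho> * \<bar>of_int n\<bar>) * (\<bar>of_int n\<bar> ^ (2 * m) + 1) \<le>
     (fact (2 * m) / \<delta> ^ (2 * m) + 1) * exp (\<sigma> * \<bar>of_int n\<bar>) ^ 2"
    by (simp add: exp_double)
qed

text \<open>The term is quadratic in the coefficient. One of the two factors is bounded by the whole
  weighted sum, which turns the l^2 term into a summable l^1 term. The constant does not depend on
  \<open>f\<close>, as the estimates of remainders require.\<close>

lemma H_term_strip_series_le:
  assumes "\<rho> > 0" "2 * pi * \<rho> < \<sigma>"
  obtains C where "C \<ge> 0" "\<And>f n. wsummable \<sigma> f \<Longrightarrow>
    H_term \<rho> m (strip_series \<rho> f) n \<le> C * (wnorm \<sigma> f * (norm (f n) * exp (\<sigma> * \<bar>of_int n\<bar>)))"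
proof -
  obtain C where C: "C \<ge> 0" "\<And>n::int. exp (4 * pi * \<rho> * \<bar>of_int n\<bar>) * (\<bar>of_int n\<bar> ^ (2 * m) + 1) \<le> C * exp (\<sigma> * \<bar>of_int n\<bar>) ^ 2"
    using H_weight_le[OF assms(2)] by metis
  show ?thesis
  proof (rule that[OF C(1)])
    fix f n assume f: "wsummable \<sigma> f"
    let ?g = "norm (f n) * exp (\<sigma> * \<bar>of_int n\<bar>)"
    have \<sigma>: "\<sigma> \<ge> 0" using assms by (smt (verit) mult_nonneg_nonneg pi_ge_zero)
    have "H_term \<rho> m (strip_series \<rho> f) n = norm (f n) ^ 2 * (exp (4 * pi * \<rho> * \<bar>of_int n\<bar>) * (\<bar>of_int n\<bar> ^ (2 * m) + 1))"
      by (simp add: H_term_def fourier_coeff_strip_series[OF f \<sigma> assms(1)])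
    also have "\<dots> \<le> norm (f n) ^ 2 * (C * exp (\<sigma> * \<bar>of_int n\<bar>) ^ 2)"
      by (intro mult_left_mono C) auto
    also have "\<dots> = C * (?g * ?g)" by (simp add: power2_eq_square)
    also have "\<dots> \<le> C * (wnorm \<sigma> f * ?g)"
      by (intro mult_left_mono mult_right_mono wsummable_imp_term_le f C(1)) auto
    finally show "H_term \<rho> m (strip_series \<rho> f) n \<le> C * (wnorm \<sigma> f * ?g)" .
  qed
qed

lemma H_term_nonneg: "H_term \<rho> m f n \<ge> 0"
  by (simp add: H_term_def)

lemma H_term_summable:
  assumes "\<rho> > 0" "2 * pi * \<rho> < \<sigma>" "wsummable \<sigma> f"
  shows "H_term \<rho> m (strip_series \<rho> f) summable_on UNIV"
proof -
  obtain C where C: "C \<ge> 0" "\<And>f n. wsummable \<sigma> f \<Longrightarrow>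
    H_term \<rho> m (strip_series \<rho> f) n \<le> C * (wnorm \<sigma> f * (norm (f n) * exp (\<sigma> * \<bar>of_int n\<bar>)))"
    using H_term_strip_series_le[OF assms(1,2)] by metis
  show ?thesis
  proof (rule summable_on_comparison_test)
    show "(\<lambda>n. C * (wnorm \<sigma> f * (norm (f n) * exp (\<sigma> * \<bar>of_int n\<bar>)))) summable_on UNIV"
      using assms(3) unfolding wsummable_def by (intro summable_on_cmult_right)
  qed (use C(2)[OF assms(3)] H_term_nonneg in auto)
qed

text \<open>Continuity of the inclusion of the weighted l^1 space into H. Convergence and
  differentiability in the norm of X thus become statements about sums of coefficients.\<close>

lemma H_norm_strip_series_le:
  assumes "\<rho> > 0" "2 * pi * \<rho> < \<sigma>"
  obtains C where "C \<ge> 0"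
    "\<And>f. wsummable \<sigma> f \<Longrightarrow> H_norm \<rho> m (strip_series \<rho> f) \<le> C * wnorm \<sigma> f"
proof -
  obtain C where C: "C \<ge> 0" "\<And>f n. wsummable \<sigma> f \<Longrightarrow>
    H_term \<rho> m (strip_series \<rho> f) n \<le> C * (wnorm \<sigma> f * (norm (f n) * exp (\<sigma> * \<bar>of_int n\<bar>)))"
    using H_term_strip_series_le[OF assms(1,2)] by metis
  show ?thesis
  proof (rule that[of "sqrt C"])
    fix f assume f: "wsummable \<sigma> f"
    have "(\<Sum>\<^sub>\<infinity>n. H_term \<rho> m (strip_series \<rho> f) n) \<le> C * (wnorm \<sigma> f * wnorm \<sigma> f)"
      by (rule has_sum_mono[OF has_sum_infsum[OF H_term_summable[OF assms f]]
            has_sum_cmult_right[OF has_sum_cmult_right[OF wnorm_has_sum[OF f]]]]) (rule C(2)[OF f])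
    then have "H_norm \<rho> m (strip_series \<rho> f) \<le> sqrt (C * (wnorm \<sigma> f * wnorm \<sigma> f))"
      by (simp add: H_norm_def)
    then show "H_norm \<rho> m (strip_series \<rho> f) \<le> sqrt C * wnorm \<sigma> f"
      by (simp add: real_sqrt_mult wnorm_nonneg)
  qed (use C in simp)
qed

lemma open_strip: "open (strip \<rho>)"
  unfolding strip_def by (intro open_Collect_less continuous_intros)

lemma in_stripD: "x \<in> strip \<rho> \<Longrightarrow> 2 * pi * \<rho> < \<sigma> \<Longrightarrow> 2 * pi * \<bar>Im x\<bar> < \<sigma>"
  by (rule order.strict_trans[of _ "2 * pi * \<rho>"]) (auto simp: strip_def)

lemma strip_series_deriv:
  assumes "2 * pi * \<rho> < \<sigma>" "wsummable \<sigma> f" "x \<in> strip \<rho>"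
  shows "(strip_series \<rho> f has_field_derivative strip_series \<rho> (diff_coeff f) x) (at x)"
proof -
  have "(fourier_series f has_field_derivative strip_series \<rho> (diff_coeff f) x) (at x)"
    using fourier_series_deriv[OF assms(2) in_stripD[OF assms(3,1)]] assms(3)
    by (simp add: strip_series_def)
  then show ?thesis
    by (rule has_field_derivative_transform_within_open[OF _ open_strip assms(3)])
       (simp add: strip_series_def)
qed

lemma strip_series_in_H_space:
  assumes "\<rho> > 0" "2 * pi * \<rho> < \<sigma>" "wsummable \<sigma> f"
  shows "strip_series \<rho> f \<in> H_space \<rho> m"
proof -
  have "strip_series \<rho> f holomorphic_on strip \<rho>"
    unfolding holomorphic_on_open[OF open_strip] by (intro ballI exI) (rule strip_series_deriv[OF assms(2,3)])
  moreover have "mode n (z + 1) = mode n z" for n z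
    using mode_of_int[of n 1] by (simp add: mode_add)
  then have "strip_series \<rho> f (z + 1) = strip_series \<rho> f z" for z
    by (simp add: fourier_series_def strip_series_def strip_def)
  moreover have "strip_series \<rho> f z = 0" if "z \<notin> strip \<rho>" for z
    using that by (simp add: strip_series_def)
  ultimately show ?thesis
    using H_term_summable[OF assms] by (simp add: H_space_def)
qed

text \<open>The claims are proved together: the next derivative in the first needs a rate from the
  second. The rate shrinks with every derivative but stays above 2 pi \<rho>, hence the existential
  quantifier.\<close>

lemma strip_series_deriv_n:
  assumes "2 * pi * \<rho> < \<sigma>" "wsummable \<sigma> f"
  shows "x \<in> strip \<rho> \<Longrightarrow> (deriv ^^ p) (strip_series \<rho> f) x = strip_series \<rho> ((diff_coeff ^^ p) f) x"
    and "\<exists>\<tau>>2 * pi * \<rho>. wsummable \<tau> ((diff_coeff ^^ p) f)"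
proof (induction p arbitrary: x)
  case (Suc p)
  obtain \<tau> where \<tau>: "2 * pi * \<rho> < \<tau>" "wsummable \<tau> ((diff_coeff ^^ p) f)"
    using Suc.IH(2) by blast
  {
    case 1
    have "((deriv ^^ p) (strip_series \<rho> f) has_field_derivative
        strip_series \<rho> (diff_coeff ((diff_coeff ^^ p) f)) x) (at x)"
      by (rule has_field_derivative_transform_within_open[OF strip_series_deriv[OF \<tau> 1] open_strip 1])
         (simp only: Suc.IH(1))
    then show ?case by (simp add: DERIV_imp_deriv)
  next
    case 2
    obtain \<upsilon> where "2 * pi * \<rho> < \<upsilon>" "\<upsilon> < \<tau>" using dense[OF \<tau>(1)] by blast
    with wsummable_diff_coeff[OF \<tau>(2)] show ?case by auto
  }
qed (use assms in auto)

subsection \<open>Analytic circles of translates\<close>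

definition rotate_coeff :: "real \<Rightarrow> (int \<Rightarrow> complex) \<Rightarrow> int \<Rightarrow> complex" where
  "rotate_coeff t f n = f n * mode n (of_real t)"

text \<open>The coefficient of h^p in \<open>rotate_coeff (t + h) f n\<close>, from the exponential
  series of \<open>mode n h\<close>.\<close>

definition taylor_coeff :: "real \<Rightarrow> (int \<Rightarrow> complex) \<Rightarrow> nat \<Rightarrow> int \<Rightarrow> complex" where
  "taylor_coeff t f p n = rotate_coeff t f n * (of_real (2 * pi * of_int n) * \<i>) ^ p / fact p"

definition pair_series :: "real \<Rightarrow> (int \<Rightarrow> complex) \<Rightarrow> (int \<Rightarrow> complex) \<Rightarrow> state" where
  "pair_series \<rho> f g x = (strip_series \<rho> f x, strip_series \<rho> g x)"

lemma norm_rotate_coeff [simp]: "norm (rotate_coeff t f n) = norm (f n)"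
  by (simp add: rotate_coeff_def norm_mult)

lemma wsummable_rotate [simp]: "wsummable \<sigma> (rotate_coeff t f) = wsummable \<sigma> f"
  by (simp add: wsummable_def)

lemma rotate_diff_coeff: "rotate_coeff t (diff_coeff f) = diff_coeff (rotate_coeff t f)"
  by (simp add: fun_eq_iff rotate_coeff_def diff_coeff_def)

lemma strip_series_eqI:
  assumes "\<And>x. x \<in> strip \<rho> \<Longrightarrow> ((\<lambda>n. f n * mode n x) has_sum F x) UNIV"
    and "\<And>x. x \<notin> strip \<rho> \<Longrightarrow> F x = 0"
  shows "strip_series \<rho> f = F"
  using assms by (auto simp: strip_series_def fourier_series_def fun_eq_iff infsumI)

lemma strip_series_has_sum:
  assumes "2 * pi * \<rho> < \<sigma>" "wsummable \<sigma> f" "x \<in> strip \<rho>"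
  shows "((\<lambda>n. f n * mode n x) has_sum strip_series \<rho> f x) UNIV"
  using fourier_series_has_sum[OF assms(2) less_imp_le[OF in_stripD[OF assms(3,1)]]] assms(3)
  by (simp add: strip_series_def)

lemma strip_series_outside [simp]: "x \<notin> strip \<rho> \<Longrightarrow> strip_series \<rho> f x = 0"
  by (simp add: strip_series_def)

lemma strip_series_cmult:
  assumes "2 * pi * \<rho> < \<sigma>" "wsummable \<sigma> f"
  shows "strip_series \<rho> (\<lambda>n. c * f n) = (\<lambda>x. c * strip_series \<rho> f x)"
  by (rule strip_series_eqI)
     (use has_sum_cmult_right[OF strip_series_has_sum[OF assms]] in \<open>auto simp: mult_ac\<close>)

lemma strip_series_add:
  assumes "2 * pi * \<rho> < \<sigma>" "wsummable \<sigma> f" "wsummable \<sigma> g"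
  shows "strip_series \<rho> (\<lambda>n. f n + g n) = (\<lambda>x. strip_series \<rho> f x + strip_series \<rho> g x)"
  by (rule strip_series_eqI)
     (use has_sum_add[OF strip_series_has_sum[OF assms(1,2)] strip_series_has_sum[OF assms(1,3)]]
       in \<open>auto simp: distrib_right\<close>)

lemma strip_series_diff:
  assumes "2 * pi * \<rho> < \<sigma>" "wsummable \<sigma> f" "wsummable \<sigma> g"
  shows "strip_series \<rho> (\<lambda>n. f n - g n) = (\<lambda>x. strip_series \<rho> f x - strip_series \<rho> g x)"
  by (rule strip_series_eqI)
     (use has_sum_diff[OF strip_series_has_sum[OF assms(1,2)] strip_series_has_sum[OF assms(1,3)]]
       in \<open>auto simp: left_diff_distrib\<close>)

lemma strip_series_0: "strip_series \<rho> (\<lambda>n. 0) = (\<lambda>x. 0)"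
  by (rule strip_series_eqI) auto

lemma wsummable_0: "wsummable \<sigma> (\<lambda>n. 0)"
  by (simp add: wsummable_def)

lemma wsummable_sum:
  assumes "\<And>\<alpha>. \<alpha> \<in> F \<Longrightarrow> wsummable \<sigma> (f \<alpha>)"
  shows "wsummable \<sigma> (\<lambda>n. \<Sum>\<alpha>\<in>F. f \<alpha> n)"
  using assms by (induction F rule: infinite_finite_induct) (auto intro: wsummable_0 wsummable_add)

lemma strip_series_sum:
  assumes "2 * pi * \<rho> < \<sigma>" "\<And>\<alpha>. \<alpha> \<in> F \<Longrightarrow> wsummable \<sigma> (f \<alpha>)"
  shows "strip_series \<rho> (\<lambda>n. \<Sum>\<alpha>\<in>F. f \<alpha> n) = (\<lambda>x. \<Sum>\<alpha>\<in>F. strip_series \<rho> (f \<alpha>) x)"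
  using assms(2)
  by (induction F rule: infinite_finite_induct)
     (auto simp: strip_series_0 strip_series_add[OF assms(1)] wsummable_sum)

lemma pair_series_in_X_space:
  assumes "\<rho> > 0" "2 * pi * \<rho> < \<sigma>" "wsummable \<sigma> f" "wsummable \<sigma> g"
  shows "pair_series \<rho> f g \<in> X_space \<rho> m"
  using strip_series_in_H_space[OF assms(1,2,3)] strip_series_in_H_space[OF assms(1,2,4)]
  by (simp add: X_space_def pair_series_def comp_def)

lemma X_norm_nonneg: "X_norm \<rho> m z \<ge> 0"
  by (simp add: X_norm_def)

lemma X_norm_pair_series_le:
  assumes "\<rho> > 0" "2 * pi * \<rho> < \<sigma>"
  obtains C where "C \<ge> 0" "\<And>f g. wsummable \<sigma> f \<Longrightarrow> wsummable \<sigma> g \<Longrightarrow>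
    X_norm \<rho> m (pair_series \<rho> f g) \<le> C * (wnorm \<sigma> f + wnorm \<sigma> g)"
proof -
  obtain C where C: "C \<ge> 0"
    "\<And>f. wsummable \<sigma> f \<Longrightarrow> H_norm \<rho> m (strip_series \<rho> f) \<le> C * wnorm \<sigma> f"
    using H_norm_strip_series_le[OF assms] by metis
  obtain D where D: "D \<ge> 0"
    "\<And>f. wsummable \<sigma> f \<Longrightarrow> H_norm \<rho> (m + 1) (strip_series \<rho> f) \<le> D * wnorm \<sigma> f"
    using H_norm_strip_series_le[OF assms] by metis
  show ?thesis
  proof (rule that)
    show "C + D \<ge> 0" using C D by simp
    fix f g assume f: "wsummable \<sigma> f" and g: "wsummable \<sigma> g"
    have nn: "H_norm \<rho> m h \<ge> 0" for m h
      by (auto simp: H_norm_def intro!: infsum_nonneg H_term_nonneg)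
    have "X_norm \<rho> m (pair_series \<rho> f g) \<le> H_norm \<rho> m (strip_series \<rho> f) + H_norm \<rho> (m + 1) (strip_series \<rho> g)"
      unfolding X_norm_def
      by (rule order_trans[OF sqrt_sum_squares_le_sum]) (auto simp: nn pair_series_def comp_def)
    also have "\<dots> \<le> C * wnorm \<sigma> f + D * wnorm \<sigma> g"
      by (intro add_mono C D f g)
    also have "\<dots> \<le> (C + D) * (wnorm \<sigma> f + wnorm \<sigma> g)"
      using C D wnorm_nonneg[of \<sigma> f] wnorm_nonneg[of \<sigma> g] by (simp add: algebra_simps)
    finally show "X_norm \<rho> m (pair_series \<rho> f g) \<le> (C + D) * (wnorm \<sigma> f + wnorm \<sigma> g)" .
  qed
qed

section \<open>Taylor expansion in the translation parameter\<close>

lemma exp_has_sum: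
  fixes z :: "'a :: {banach, real_normed_field}"
  shows "((\<lambda>p. z ^ p / fact p) has_sum exp z) UNIV"
proof (rule norm_summable_imp_has_sum)
  show "summable (\<lambda>p. norm (z ^ p / fact p))"
    using summable_norm_exp[of z] by (simp add: scaleR_conv_of_real field_simps norm_divide norm_power)
  show "(\<lambda>p. z ^ p / fact p) sums exp z"
    using exp_converges[of z] by (simp add: scaleR_conv_of_real field_simps)
qed

text \<open>The tail of the series at \<open>z\<close> is dominated by the same tail at |z|.
  \<open>F\<close> is an arbitrary finite set because \<open>X_analytic\<close> takes limits along
  finite index sets, not along initial segments.\<close>

lemma norm_exp_diff_sum_le:
  fixes z :: complex
  assumes "finite F"
  shows "norm (exp z - (\<Sum>p\<in>F. z ^ p / fact p)) \<le> exp (norm z) - (\<Sum>p\<in>F. norm z ^ p / fact p)"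
proof (rule norm_infsum_le)
  have "((\<lambda>p. z ^ p / fact p) has_sum (exp z - (\<Sum>p\<in>F. z ^ p / fact p))) (UNIV - F)"
    by (intro has_sum_Diff exp_has_sum has_sum_finite assms) auto
  then show "((\<lambda>p. z ^ p / fact p) has_sum (exp z - (\<Sum>p\<in>F. z ^ p / fact p))) (UNIV - F)" .
  show "((\<lambda>p. norm z ^ p / fact p) has_sum (exp (norm z) - (\<Sum>p\<in>F. norm z ^ p / fact p))) (UNIV - F)"
    by (intro has_sum_Diff exp_has_sum has_sum_finite assms) auto
qed (simp add: norm_divide norm_power)

lemma wsummable_taylor_coeff:
  assumes "wsummable \<sigma>' f" "\<sigma> < \<sigma>'"
  shows "wsummable \<sigma> (taylor_coeff t f p)"
proof -
  have "wsummable \<sigma> (\<lambda>n. (of_real (2 * pi) * \<i>) ^ p / fact p * (of_int n ^ p * rotate_coeff t f n))"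
    using assms by (intro wsummable_cmult wsummable_power_mult[of \<sigma>']) auto
  then show ?thesis
    by (simp add: taylor_coeff_def[abs_def] power_mult_distrib mult_ac)
qed

text \<open>In the double family over mode \<open>n\<close> and order \<open>p\<close> all terms are
  nonnegative, so the order of summation may be exchanged. Summing over \<open>p\<close> first gives
  exp (2 pi |n| |h|), that is, an increase of the rate by 2 pi |h|.\<close>

lemma taylor_coeff_has_sum:
  assumes "wsummable \<sigma>' f" "\<sigma> < \<sigma>'" "\<sigma> + 2 * pi * \<bar>h\<bar> \<le> \<sigma>'"
  shows "((\<lambda>p. \<bar>h\<bar> ^ p * wnorm \<sigma> (taylor_coeff t f p)) has_sum wnorm (\<sigma> + 2 * pi * \<bar>h\<bar>) f) UNIV"
proof -
  define G where "G = (\<lambda>(n::int, p). norm (f n) * exp (\<sigma> * \<bar>of_int n\<bar>) * ((2 * pi * \<bar>of_int n\<bar> * \<bar>h\<bar>) ^ p / fact p))"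
  let ?\<tau> = "\<sigma> + 2 * pi * \<bar>h\<bar>"
  have row: "((\<lambda>p. G (n, p)) has_sum norm (f n) * exp (?\<tau> * \<bar>of_int n\<bar>)) UNIV" for n
  proof -
    have "norm (f n) * exp (\<sigma> * \<bar>of_int n\<bar>) * exp (2 * pi * \<bar>of_int n\<bar> * \<bar>h\<bar>) = norm (f n) * exp (?\<tau> * \<bar>of_int n\<bar>)"
      by (simp add: distrib_left distrib_right exp_add mult_ac)
    with has_sum_cmult_right[OF exp_has_sum[of "2 * pi * \<bar>real_of_int n\<bar> * \<bar>h\<bar>"], of "norm (f n) * exp (\<sigma> * \<bar>of_int n\<bar>)"]
    show ?thesis by (simp add: G_def)
  qed
  have \<tau>: "((\<lambda>n. norm (f n) * exp (?\<tau> * \<bar>of_int n\<bar>)) has_sum wnorm ?\<tau> f) UNIV"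
    by (rule wnorm_has_sum[OF wsummable_mono[OF assms(1,3)]])
  have "G summable_on (UNIV \<times> UNIV)"
    by (rule summable_on_SigmaI[OF row has_sum_imp_summable[OF \<tau>]]) (auto simp: G_def)
  then have G: "(G has_sum wnorm ?\<tau> f) (UNIV \<times> UNIV)"
    by (intro has_sum_SigmaI[OF row \<tau>])
  then have "((\<lambda>(p, n). G (n, p)) has_sum wnorm ?\<tau> f) (UNIV \<times> UNIV)"
    by (rule has_sum_swap[THEN iffD1])
  then show ?thesis
  proof (rule has_sum_Sigma')
    fix p :: nat
    have "G (n, p) = \<bar>h\<bar> ^ p * (norm (taylor_coeff t f p n) * exp (\<sigma> * \<bar>of_int n\<bar>))" for n
      by (simp add: G_def taylor_coeff_def norm_mult norm_divide norm_power power_mult_distrib mult_ac)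
    then show "((\<lambda>n. case (p, n) of (p, n) \<Rightarrow> G (n, p)) has_sum \<bar>h\<bar> ^ p * wnorm \<sigma> (taylor_coeff t f p)) UNIV"
      by (simp add: has_sum_cmult_right wnorm_has_sum wsummable_taylor_coeff[OF assms(1,2)])
  qed
qed

lemma has_sum_sum:
  fixes f :: "'i \<Rightarrow> 'a \<Rightarrow> 'b :: topological_comm_monoid_add"
  assumes "\<And>i. i \<in> I \<Longrightarrow> (f i has_sum s i) A"
  shows "((\<lambda>x. \<Sum>i\<in>I. f i x) has_sum (\<Sum>i\<in>I. s i)) A"
  using assms by (induction I rule: infinite_finite_induct) (auto intro: has_sum_add)

text \<open>The exponential tail estimate, applied mode by mode and summed. The bound is the tail of
  the sum in \<open>taylor_coeff_has_sum\<close>, so it tends to 0 as \<open>F\<close>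
  grows.\<close>

lemma taylor_remainder_wnorm:
  fixes t h :: real
  assumes "wsummable \<sigma>' f" "\<sigma> < \<sigma>'" "\<sigma> + 2 * pi * \<bar>h\<bar> \<le> \<sigma>'" "finite F"
  defines "R \<equiv> \<lambda>n. rotate_coeff (t + h) f n - (\<Sum>p\<in>F. of_real (h ^ p) * taylor_coeff t f p n)"
  shows "wsummable \<sigma> R"
    and "wnorm \<sigma> R \<le> wnorm (\<sigma> + 2 * pi * \<bar>h\<bar>) f - (\<Sum>p\<in>F. \<bar>h\<bar> ^ p * wnorm \<sigma> (taylor_coeff t f p))"
proof -
  let ?\<tau> = "\<sigma> + 2 * pi * \<bar>h\<bar>"
  have "wsummable \<sigma> (\<lambda>n. rotate_coeff (t + h) f n + (-1) * (\<Sum>p\<in>F. of_real (h ^ p) * taylor_coeff t f p n))"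
    by (intro wsummable_add wsummable_cmult wsummable_sum wsummable_taylor_coeff[OF assms(1,2)])
       (use wsummable_mono[OF assms(1)] assms(2) in simp)
  then show R: "wsummable \<sigma> R" by (simp add: R_def)
  have "((\<lambda>n. norm (f n) * exp (?\<tau> * \<bar>of_int n\<bar>) -
      (\<Sum>p\<in>F. \<bar>h\<bar> ^ p * (norm (taylor_coeff t f p n) * exp (\<sigma> * \<bar>of_int n\<bar>)))) has_sum
      (wnorm ?\<tau> f - (\<Sum>p\<in>F. \<bar>h\<bar> ^ p * wnorm \<sigma> (taylor_coeff t f p)))) UNIV"
    by (intro has_sum_diff has_sum_sum has_sum_cmult_right wnorm_has_sum wsummable_taylor_coeff[OF assms(1,2)]
        wsummable_mono[OF assms(1,3)])
  then show "wnorm \<sigma> R \<le> wnorm ?\<tau> f - (\<Sum>p\<in>F. \<bar>h\<bar> ^ p * wnorm \<sigma> (taylor_coeff t f p))"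
  proof (rule has_sum_mono[OF wnorm_has_sum[OF R]])
    fix n :: int
    define z where "z = of_real (2 * pi * of_int n) * \<i> * of_real h"
    have nz: "norm z = 2 * pi * \<bar>of_int n\<bar> * \<bar>h\<bar>" by (simp add: z_def norm_mult)
    have "R n = rotate_coeff t f n * (exp z - (\<Sum>p\<in>F. z ^ p / fact p))"
      by (simp add: R_def z_def rotate_coeff_def taylor_coeff_def mode_add right_diff_distrib
          sum_distrib_left power_mult_distrib mult_ac) (simp add: mode_def mult_ac)
    then have "norm (R n) \<le> norm (f n) * (exp (norm z) - (\<Sum>p\<in>F. norm z ^ p / fact p))"
      using norm_exp_diff_sum_le[OF assms(4), of z] by (simp add: norm_mult mult_left_mono)
    then have "norm (R n) * exp (\<sigma> * \<bar>of_int n\<bar>) \<le>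
        norm (f n) * (exp (norm z) - (\<Sum>p\<in>F. norm z ^ p / fact p)) * exp (\<sigma> * \<bar>of_int n\<bar>)"
      by (rule mult_right_mono) auto
    also have "\<dots> = norm (f n) * (exp (norm z) * exp (\<sigma> * \<bar>of_int n\<bar>)) -
       (\<Sum>p\<in>F. norm (f n) * (norm z ^ p / fact p) * exp (\<sigma> * \<bar>of_int n\<bar>))"
      by (simp add: right_diff_distrib left_diff_distrib sum_distrib_left sum_distrib_right mult_ac)
    also have "exp (norm z) * exp (\<sigma> * \<bar>of_int n\<bar>) = exp (?\<tau> * \<bar>of_int n\<bar>)"
      by (simp add: nz distrib_left distrib_right exp_add mult_ac)
    also have "(\<Sum>p\<in>F. norm (f n) * (norm z ^ p / fact p) * exp (\<sigma> * \<bar>of_int n\<bar>)) =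
        (\<Sum>p\<in>F. \<bar>h\<bar> ^ p * (norm (taylor_coeff t f p n) * exp (\<sigma> * \<bar>of_int n\<bar>)))"
      by (simp add: nz taylor_coeff_def norm_mult norm_divide norm_power power_mult_distrib mult_ac)
    finally show "norm (R n) * exp (\<sigma> * \<bar>of_int n\<bar>) \<le> norm (f n) * exp (?\<tau> * \<bar>of_int n\<bar>) -
      (\<Sum>p\<in>F. \<bar>h\<bar> ^ p * (norm (taylor_coeff t f p n) * exp (\<sigma> * \<bar>of_int n\<bar>)))" .
  qed
qed

lemma linear_remainder_wnorm:
  fixes t h :: real
  assumes "wsummable \<sigma>' f" "\<sigma> < \<sigma>'"
  defines "R \<equiv> \<lambda>n. rotate_coeff (t + h) f n - rotate_coeff t f n - of_real h * rotate_coeff t (diff_coeff f) n"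
  shows "wsummable \<sigma> R"
    and "wnorm \<sigma> R \<le> 4 * pi\<^sup>2 * h\<^sup>2 * wnorm \<sigma> (\<lambda>n. of_int n ^ 2 * f n)"
proof -
  note f2 = wsummable_power_mult[OF assms(1,2), of 2]
  have le: "norm (R n) * exp (\<sigma> * \<bar>of_int n\<bar>) \<le>
      4 * pi\<^sup>2 * h\<^sup>2 * (norm (of_int n ^ 2 * f n) * exp (\<sigma> * \<bar>of_int n\<bar>))" for n
  proof -
    define z where "z = of_real (2 * pi * of_int n) * \<i> * of_real h"
    have nz: "norm z = 2 * pi * \<bar>of_int n\<bar> * \<bar>h\<bar>" by (simp add: z_def norm_mult)
    \<comment> \<open>\<open>z\<close> is purely imaginary because the translation is real. No
      exponential factor arises, so the quadratic estimate holds for every \<open>h\<close> with the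
      same rate.\<close>
    have "norm (exp z - 1 - z) \<le> norm z ^ 2"
      using Taylor_exp[of z 1] by (simp add: power2_eq_square z_def algebra_simps)
    moreover have "R n = rotate_coeff t f n * (exp z - 1 - z)"
      by (simp add: R_def z_def rotate_coeff_def diff_coeff_def mode_add algebra_simps) (simp add: mode_def mult_ac)
    ultimately have "norm (R n) \<le> norm (f n) * norm z ^ 2"
      by (simp add: norm_mult mult_left_mono)
    then have "norm (R n) * exp (\<sigma> * \<bar>of_int n\<bar>) \<le> norm (f n) * norm z ^ 2 * exp (\<sigma> * \<bar>of_int n\<bar>)"
      by (rule mult_right_mono) auto
    then show ?thesis by (simp add: nz norm_mult norm_power power_mult_distrib mult_ac)
  qed
  show R: "wsummable \<sigma> R" by (rule wsummable_le[OF f2 le])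
  show "wnorm \<sigma> R \<le> 4 * pi\<^sup>2 * h\<^sup>2 * wnorm \<sigma> (\<lambda>n. of_int n ^ 2 * f n)"
    by (rule has_sum_mono[OF wnorm_has_sum[OF R] has_sum_cmult_right[OF wnorm_has_sum[OF f2]]]) (rule le)
qed

section \<open>The circle of translates as an analytic embedding\<close>

lemma rotate_coeff_cong_int:
  assumes "t - t' \<in> \<int>"
  shows "rotate_coeff t f = rotate_coeff t' f"
proof -
  from assms obtain k where "t - t' = of_int k" by (elim Ints_cases)
  then have "complex_of_real t = of_real t' + of_int k"
    by (metis add.commute diff_add_cancel of_real_add of_real_of_int_eq)
  then show ?thesis by (simp add: fun_eq_iff rotate_coeff_def mode_add)
qed

lemma mode_1_eq_imp_int:
  assumes "mode 1 (of_real t) = mode 1 (of_real t')"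
  shows "t - t' \<in> \<int>"
proof -
  obtain k :: int where "of_real (2 * pi) * \<i> * of_real t = of_real (2 * pi) * \<i> * of_real t' + (of_int (2 * k) * pi) * \<i>"
    using assms unfolding mode_def by (auto simp: exp_eq)
  then have "of_real (2 * pi * t) = complex_of_real (2 * pi * (t' + of_int k))"
    by (auto simp: complex_eq_iff algebra_simps)
  then have "t - t' = of_int k" unfolding of_real_eq_iff by simp
  then show ?thesis by simp
qed

text \<open>Translation multiplies the first Fourier coefficient of the second component by a unit
  complex number. As this coefficient is nonzero, it determines the translation modulo integers,
  which gives injectivity, and its derivative does not vanish, which gives immersion. Analyticity
  comes from the Taylor series in the translation.\<close>

lemma analytic_torus_embedding_rotate:
  fixes i0 :: "'l::finite"
  assumes UNIV1: "(UNIV :: 'l set) = {i0}" and \<rho>: "\<rho> > 0" and \<sigma>': "2 * pi * \<rho> < \<sigma>'"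
    and f: "wsummable \<sigma>' f" and g: "wsummable \<sigma>' g" and g1: "g 1 \<noteq> 0"
  shows "analytic_torus_embedding \<rho> m
     (\<lambda>\<theta> :: real ^ 'l. pair_series \<rho> (rotate_coeff (\<theta> $ i0) f) (rotate_coeff (\<theta> $ i0) g))
     (\<lambda>\<theta> j. pair_series \<rho> (rotate_coeff (\<theta> $ i0) (diff_coeff f)) (rotate_coeff (\<theta> $ i0) (diff_coeff g)))"
    (is "analytic_torus_embedding \<rho> m ?K ?D")
proof -
  \<comment> \<open>Estimates in the norm of X use the rate \<sigma>; the gap up to \<sigma>' pays
    for derivatives and for the radius of convergence.\<close>
  obtain \<sigma> where \<sigma>: "2 * pi * \<rho> < \<sigma>" "\<sigma> < \<sigma>'" using dense[OF \<sigma>'] by blast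
  have \<sigma>0: "\<sigma> \<ge> 0" using \<sigma>(1) \<rho> by (smt (verit) mult_nonneg_nonneg pi_ge_zero)
  note f\<sigma> = wsummable_mono[OF f less_imp_le[OF \<sigma>(2)]]
  note g\<sigma> = wsummable_mono[OF g less_imp_le[OF \<sigma>(2)]]
  note df = wsummable_diff_coeff[OF f \<sigma>(2)]
  note dg = wsummable_diff_coeff[OF g \<sigma>(2)]
  obtain C where C: "C \<ge> 0" "\<And>f g. wsummable \<sigma> f \<Longrightarrow> wsummable \<sigma> g \<Longrightarrow>
    X_norm \<rho> m (pair_series \<rho> f g) \<le> C * (wnorm \<sigma> f + wnorm \<sigma> g)"
    using X_norm_pair_series_le[OF \<rho> \<sigma>(1)] by metis
  have sum1: "(\<Sum>j\<in>(UNIV :: 'l set). F j) = F i0" for F :: "'l \<Rightarrow> 'b::comm_monoid_add"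
    by (simp add: UNIV1)
  have prod1: "(\<Prod>j\<in>(UNIV :: 'l set). F j) = F i0" for F :: "'l \<Rightarrow> 'b::comm_monoid_mult"
    by (simp add: UNIV1)
  \<comment> \<open>In dimension one a multi-index is a single exponent, so sums over multi-indices
    reduce to sums over natural numbers.\<close>
  have bij: "bij_betw (\<lambda>\<alpha> :: 'l \<Rightarrow> nat. \<alpha> i0) UNIV UNIV"
  proof (rule bij_betwI[where g = "\<lambda>p _. p"])
    show "(\<lambda>_. \<alpha> i0) = \<alpha>" for \<alpha> :: "'l \<Rightarrow> nat"
      using UNIV1 by (metis UNIV_I ext singletonD)
  qed auto
  have embed: "?K \<theta> = ?K \<theta>' \<longleftrightarrow> (\<forall>i. \<theta> $ i - \<theta>' $ i \<in> \<int>)" for \<theta> \<theta>'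
  proof
    assume "?K \<theta> = ?K \<theta>'"
    then have "snd \<circ> ?K \<theta> = snd \<circ> ?K \<theta>'" by simp
    then have "strip_series \<rho> (rotate_coeff (\<theta> $ i0) g) = strip_series \<rho> (rotate_coeff (\<theta>' $ i0) g)"
      by (simp add: comp_def pair_series_def)
    then have "fourier_coeff (strip_series \<rho> (rotate_coeff (\<theta> $ i0) g)) 1 =
        fourier_coeff (strip_series \<rho> (rotate_coeff (\<theta>' $ i0) g)) 1"
      by simp
    then have "rotate_coeff (\<theta> $ i0) g 1 = rotate_coeff (\<theta>' $ i0) g 1"
      by (subst (asm) (1 2) fourier_coeff_strip_series[of \<sigma>]) (use g\<sigma> \<sigma>0 \<rho> in auto)
    then have "\<theta> $ i0 - \<theta>' $ i0 \<in> \<int>"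
      using g1 by (intro mode_1_eq_imp_int) (simp add: rotate_coeff_def)
    then show "\<forall>i. \<theta> $ i - \<theta>' $ i \<in> \<int>"
      using UNIV1 by (metis UNIV_I singletonD)
  next
    assume "\<forall>i. \<theta> $ i - \<theta>' $ i \<in> \<int>"
    then have "rotate_coeff (\<theta> $ i0) h = rotate_coeff (\<theta>' $ i0) h" for h
      by (simp add: rotate_coeff_cong_int)
    then show "?K \<theta> = ?K \<theta>'" by simp
  qed
  have analytic: "X_analytic \<rho> m ?K"
    unfolding X_analytic_def
  proof (intro allI exI conjI impI)
    fix \<theta> :: "real ^ 'l"
    define t where "t = \<theta> $ i0"
    define c where "c = (\<lambda>\<alpha> :: 'l \<Rightarrow> nat. pair_series \<rho> (taylor_coeff t f (\<alpha> i0)) (taylor_coeff t g (\<alpha> i0)))"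
    have wt: "wsummable \<sigma> (taylor_coeff t f p)" "wsummable \<sigma> (taylor_coeff t g p)" for p
      using wsummable_taylor_coeff[OF f \<sigma>(2)] wsummable_taylor_coeff[OF g \<sigma>(2)] by auto
    \<comment> \<open>The radius of convergence: a displacement \<open>h\<close> costs 2 pi |h| of
      the rate, and \<sigma>' - \<sigma> is available.\<close>
    show "(\<sigma>' - \<sigma>) / (2 * pi) > 0" using \<sigma> by simp
    show "pair_series \<rho> (taylor_coeff (\<theta> $ i0) f (\<alpha> i0)) (taylor_coeff (\<theta> $ i0) g (\<alpha> i0)) \<in> X_space \<rho> m" for \<alpha>
      by (intro pair_series_in_X_space[OF \<rho> \<sigma>(1)] wt[unfolded t_def])
    fix h :: "real ^ 'l"
    assume h: "norm h < (\<sigma>' - \<sigma>) / (2 * pi)"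
    define s where "s = h $ i0"
    have "\<bar>s\<bar> < (\<sigma>' - \<sigma>) / (2 * pi)"
      using h component_le_norm_cart[of h i0] by (simp add: s_def)
    then have s: "\<sigma> + 2 * pi * \<bar>s\<bar> \<le> \<sigma>'" by (simp add: field_simps)
    define W where "W = (\<lambda>p. \<bar>s\<bar> ^ p * wnorm \<sigma> (taylor_coeff t f p) + \<bar>s\<bar> ^ p * wnorm \<sigma> (taylor_coeff t g p))"
    define T where "T = wnorm (\<sigma> + 2 * pi * \<bar>s\<bar>) f + wnorm (\<sigma> + 2 * pi * \<bar>s\<bar>) g"
    have "(W has_sum T) UNIV"
      unfolding W_def T_def
      by (intro has_sum_add taylor_coeff_has_sum[OF f \<sigma>(2) s] taylor_coeff_has_sum[OF g \<sigma>(2) s])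
    then have W: "((\<lambda>\<alpha> :: 'l \<Rightarrow> nat. W (\<alpha> i0)) has_sum T) UNIV"
      by (simp add: has_sum_reindex_bij_betw[OF bij])
    have "(\<lambda>\<alpha>. \<bar>s\<bar> ^ \<alpha> i0 * X_norm \<rho> m (c \<alpha>)) summable_on UNIV"
    proof (rule summable_on_comparison_test[OF summable_on_cmult_right[OF has_sum_imp_summable[OF W], of C]])
      fix \<alpha> :: "'l \<Rightarrow> nat"
      have "\<bar>s\<bar> ^ \<alpha> i0 * X_norm \<rho> m (c \<alpha>) \<le> \<bar>s\<bar> ^ \<alpha> i0 * (C * (wnorm \<sigma> (taylor_coeff t f (\<alpha> i0)) + wnorm \<sigma> (taylor_coeff t g (\<alpha> i0))))"
        unfolding c_def by (intro mult_left_mono C wt) auto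
      then show "\<bar>s\<bar> ^ \<alpha> i0 * X_norm \<rho> m (c \<alpha>) \<le> C * W (\<alpha> i0)"
        by (simp add: W_def algebra_simps)
    qed (simp add: X_norm_nonneg)
    then show "(\<lambda>\<alpha>. (\<Prod>i\<in>UNIV. \<bar>h $ i\<bar> ^ \<alpha> i) * X_norm \<rho> m
        (pair_series \<rho> (taylor_coeff (\<theta> $ i0) f (\<alpha> i0)) (taylor_coeff (\<theta> $ i0) g (\<alpha> i0)))) summable_on UNIV"
      by (simp add: prod1 s_def c_def t_def)
    have "((\<lambda>F. X_norm \<rho> m (\<lambda>x. ?K (\<theta> + h) x - (\<Sum>\<alpha>\<in>F. s ^ \<alpha> i0 *\<^sub>R c \<alpha> x))) \<longlongrightarrow> 0)
       (finite_subsets_at_top UNIV)"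
    proof (rule Lim_null_comparison)
      show "\<forall>\<^sub>F F in finite_subsets_at_top UNIV.
         norm (X_norm \<rho> m (\<lambda>x. ?K (\<theta> + h) x - (\<Sum>\<alpha>\<in>F. s ^ \<alpha> i0 *\<^sub>R c \<alpha> x))) \<le> C * (T - (\<Sum>\<alpha>\<in>F. W (\<alpha> i0)))"
      proof (rule eventually_finite_subsets_at_top_weakI)
        fix F :: "('l \<Rightarrow> nat) set" assume F: "finite F"
        define P where "P = (\<lambda>\<alpha> :: 'l \<Rightarrow> nat. \<alpha> i0) ` F"
        have P: "finite P" using F by (simp add: P_def)
        have sumP: "(\<Sum>p\<in>P. u p) = (\<Sum>\<alpha>\<in>F. u (\<alpha> i0))" for u :: "nat \<Rightarrow> 'b::comm_monoid_add"
          unfolding P_def by (subst sum.reindex)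
            (use bij in \<open>auto simp: bij_betw_def inj_on_def\<close>)
        define R where "R = (\<lambda>f n. rotate_coeff (t + s) f n - (\<Sum>p\<in>P. of_real (s ^ p) * taylor_coeff t f p n))"
        have Rf: "wsummable \<sigma> (R f)" "wnorm \<sigma> (R f) \<le> wnorm (\<sigma> + 2 * pi * \<bar>s\<bar>) f - (\<Sum>p\<in>P. \<bar>s\<bar> ^ p * wnorm \<sigma> (taylor_coeff t f p))"
          unfolding R_def by (fact taylor_remainder_wnorm[OF f \<sigma>(2) s P])+
        have Rg: "wsummable \<sigma> (R g)" "wnorm \<sigma> (R g) \<le> wnorm (\<sigma> + 2 * pi * \<bar>s\<bar>) g - (\<Sum>p\<in>P. \<bar>s\<bar> ^ p * wnorm \<sigma> (taylor_coeff t g p))"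
          unfolding R_def by (fact taylor_remainder_wnorm[OF g \<sigma>(2) s P])+
        have series_R: "strip_series \<rho> (R u) x = strip_series \<rho> (rotate_coeff (t + s) u) x -
            (\<Sum>\<alpha>\<in>F. of_real (s ^ \<alpha> i0) * strip_series \<rho> (taylor_coeff t u (\<alpha> i0)) x)"
          if u: "wsummable \<sigma>' u" for u x
        proof -
          note wu = wsummable_taylor_coeff[OF u \<sigma>(2)]
          have "strip_series \<rho> (R u) = (\<lambda>x. strip_series \<rho> (rotate_coeff (t + s) u) x -
              strip_series \<rho> (\<lambda>n. \<Sum>p\<in>P. of_real (s ^ p) * taylor_coeff t u p n) x)"
            unfolding R_def
            by (intro strip_series_diff[OF \<sigma>(1)] wsummable_sum wsummable_cmult wu)
               (use wsummable_mono[OF u less_imp_le[OF \<sigma>(2)]] in simp)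
          also have "strip_series \<rho> (\<lambda>n. \<Sum>p\<in>P. of_real (s ^ p) * taylor_coeff t u p n) =
              (\<lambda>x. \<Sum>p\<in>P. of_real (s ^ p) * strip_series \<rho> (taylor_coeff t u p) x)"
            by (subst strip_series_sum[OF \<sigma>(1)])
               (auto intro!: wsummable_cmult wu simp: strip_series_cmult[OF \<sigma>(1) wu] simp del: of_real_power)
          finally show ?thesis by (simp add: sumP)
        qed
        have "(\<lambda>x. ?K (\<theta> + h) x - (\<Sum>\<alpha>\<in>F. s ^ \<alpha> i0 *\<^sub>R c \<alpha> x)) = pair_series \<rho> (R f) (R g)"
          by (rule ext)
             (simp add: pair_series_def c_def series_R[OF f] series_R[OF g] prod_eq_iff fst_sum snd_sum
               t_def s_def scaleR_conv_of_real)
        then have "X_norm \<rho> m (\<lambda>x. ?K (\<theta> + h) x - (\<Sum>\<alpha>\<in>F. s ^ \<alpha> i0 *\<^sub>R c \<alpha> x)) \<le> C * (wnorm \<sigma> (R f) + wnorm \<sigma> (R g))"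
          using C(2)[OF Rf(1) Rg(1)] by simp
        also have "\<dots> \<le> C * (T - (\<Sum>p\<in>P. W p))"
          using Rf(2) Rg(2) by (intro mult_left_mono C(1)) (simp add: T_def W_def sum.distrib)
        finally show "norm (X_norm \<rho> m (\<lambda>x. ?K (\<theta> + h) x - (\<Sum>\<alpha>\<in>F. s ^ \<alpha> i0 *\<^sub>R c \<alpha> x))) \<le> C * (T - (\<Sum>\<alpha>\<in>F. W (\<alpha> i0)))"
          by (simp add: X_norm_nonneg sumP)
      qed
      have "((\<lambda>F. C * (T - (\<Sum>\<alpha>\<in>F. W (\<alpha> i0)))) \<longlongrightarrow> C * (T - T)) (finite_subsets_at_top UNIV)"
        by (intro tendsto_intros) (use W in \<open>simp add: has_sum_def\<close>)
      then show "((\<lambda>F. C * (T - (\<Sum>\<alpha>\<in>F. W (\<alpha> i0)))) \<longlongrightarrow> 0) (finite_subsets_at_top UNIV)"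
        by simp
    qed
    then show "((\<lambda>F. X_norm \<rho> m (\<lambda>x. ?K (\<theta> + h) x - (\<Sum>\<alpha>\<in>F. (\<Prod>i\<in>UNIV. (h $ i) ^ \<alpha> i) *\<^sub>R
        pair_series \<rho> (taylor_coeff (\<theta> $ i0) f (\<alpha> i0)) (taylor_coeff (\<theta> $ i0) g (\<alpha> i0)) x))) \<longlongrightarrow> 0)
       (finite_subsets_at_top UNIV)"
      by (simp add: prod1 s_def c_def t_def)
  qed
  have deriv: "has_X_derivative \<rho> m ?K (?D \<theta>) \<theta>" for \<theta>
    unfolding has_X_derivative_def
  proof
    show "\<forall>j. ?D \<theta> j \<in> X_space \<rho> m"
      using pair_series_in_X_space[OF \<rho> \<sigma>(1)] df dg by simp
    define t where "t = \<theta> $ i0"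
    define B where "B = C * (4 * pi\<^sup>2 * (wnorm \<sigma> (\<lambda>n. of_int n ^ 2 * f n) + wnorm \<sigma> (\<lambda>n. of_int n ^ 2 * g n)))"
    have B0: "B \<ge> 0" unfolding B_def by (intro mult_nonneg_nonneg add_nonneg_nonneg wnorm_nonneg C(1)) auto
    have B: "X_norm \<rho> m (\<lambda>x. ?K (\<theta> + h) x - ?K \<theta> x - lin_map (?D \<theta>) h x) \<le> B * norm h ^ 2" for h
    proof -
      define s where "s = h $ i0"
      define R where "R = (\<lambda>f n. rotate_coeff (t + s) f n - rotate_coeff t f n - of_real s * rotate_coeff t (diff_coeff f) n)"
      have Rf: "wsummable \<sigma> (R f)" "wnorm \<sigma> (R f) \<le> 4 * pi\<^sup>2 * s\<^sup>2 * wnorm \<sigma> (\<lambda>n. of_int n ^ 2 * f n)"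
        unfolding R_def by (fact linear_remainder_wnorm[OF f \<sigma>(2)])+
      have Rg: "wsummable \<sigma> (R g)" "wnorm \<sigma> (R g) \<le> 4 * pi\<^sup>2 * s\<^sup>2 * wnorm \<sigma> (\<lambda>n. of_int n ^ 2 * g n)"
        unfolding R_def by (fact linear_remainder_wnorm[OF g \<sigma>(2)])+
      have series_R: "strip_series \<rho> (R u) x = strip_series \<rho> (rotate_coeff (t + s) u) x -
          strip_series \<rho> (rotate_coeff t u) x - of_real s * strip_series \<rho> (rotate_coeff t (diff_coeff u)) x"
        if u: "wsummable \<sigma>' u" for u x
      proof -
        have wu: "wsummable \<sigma> (rotate_coeff (t + s) u)" "wsummable \<sigma> (rotate_coeff t u)"
          "wsummable \<sigma> (rotate_coeff t (diff_coeff u))"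
          using wsummable_mono[OF u less_imp_le[OF \<sigma>(2)]] wsummable_diff_coeff[OF u \<sigma>(2)] by simp_all
        have "wsummable \<sigma> (\<lambda>n. rotate_coeff (t + s) u n + (-1) * rotate_coeff t u n)"
          by (intro wsummable_add wsummable_cmult wu)
        then have "wsummable \<sigma> (\<lambda>n. rotate_coeff (t + s) u n - rotate_coeff t u n)" by simp
        then show ?thesis
          unfolding R_def
          by (simp add: strip_series_diff[OF \<sigma>(1)] strip_series_cmult[OF \<sigma>(1)] wsummable_cmult wu[unfolded wsummable_rotate])
      qed
      have "(\<lambda>x. ?K (\<theta> + h) x - ?K \<theta> x - lin_map (?D \<theta>) h x) = pair_series \<rho> (R f) (R g)"
        by (rule ext)
           (simp add: pair_series_def lin_map_def sum1 series_R[OF f] series_R[OF g] t_def s_def scaleR_conv_of_real)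
      then have "X_norm \<rho> m (\<lambda>x. ?K (\<theta> + h) x - ?K \<theta> x - lin_map (?D \<theta>) h x) \<le> C * (wnorm \<sigma> (R f) + wnorm \<sigma> (R g))"
        using C(2)[OF Rf(1) Rg(1)] by simp
      also have "\<dots> \<le> B * \<bar>s\<bar> ^ 2"
        using mult_left_mono[OF add_mono[OF Rf(2) Rg(2)] C(1)] by (simp add: B_def algebra_simps)
      also have "\<dots> \<le> B * norm h ^ 2"
        using component_le_norm_cart[of h i0] B0 by (intro mult_left_mono power_mono) (auto simp: s_def)
      finally show ?thesis .
    qed
    show "((\<lambda>h. X_norm \<rho> m (\<lambda>x. ?K (\<theta> + h) x - ?K \<theta> x - lin_map (?D \<theta>) h x) / norm h) \<longlongrightarrow> 0) (at 0)"
    proof (rule Lim_null_comparison)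
      show "\<forall>\<^sub>F h in at 0. norm (X_norm \<rho> m (\<lambda>x. ?K (\<theta> + h) x - ?K \<theta> x - lin_map (?D \<theta>) h x) / norm h) \<le> B * norm h"
        unfolding eventually_at_filter
      proof (intro always_eventually allI impI)
        fix h :: "real ^ 'l" assume "h \<noteq> 0"
        with divide_right_mono[OF B[of h], of "norm h"]
        show "norm (X_norm \<rho> m (\<lambda>x. ?K (\<theta> + h) x - ?K \<theta> x - lin_map (?D \<theta>) h x) / norm h) \<le> B * norm h"
          by (simp add: X_norm_nonneg power2_eq_square)
      qed
      show "((\<lambda>h :: real ^ 'l. B * norm h) \<longlongrightarrow> 0) (at 0)"
        by (intro tendsto_mult_right_zero tendsto_norm_zero tendsto_ident_at)
    qed
  qed
  have immersion: "h = 0" if "lin_map (?D \<theta>) h = (\<lambda>x. 0)" for \<theta> h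
  proof -
    let ?d = "rotate_coeff (\<theta> $ i0) (diff_coeff g)"
    have "h $ i0 = 0"
    proof (rule ccontr)
      assume nz: "h $ i0 \<noteq> 0"
      have "strip_series \<rho> ?d x = 0" for x
        using fun_cong[OF that, of x] nz by (simp add: lin_map_def sum1 pair_series_def prod_eq_iff)
      then have "fourier_coeff (strip_series \<rho> ?d) 1 = 0"
        by (simp add: fourier_coeff_def)
      then have "?d 1 = 0"
        by (subst (asm) fourier_coeff_strip_series[of \<sigma>]) (use dg \<sigma>0 \<rho> in auto)
      then show False using g1 by (simp add: rotate_coeff_def diff_coeff_def mode_def)
    qed
    then show ?thesis using UNIV1 by (metis UNIV_I singletonD vec_eq_iff zero_index)
  qed
  show ?thesis
    unfolding analytic_torus_embedding_def
    using pair_series_in_X_space[OF \<rho> \<sigma>(1)] f\<sigma> g\<sigma> embed analytic deriv immersion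
    by (auto simp only: wsummable_rotate)
qed

subsection \<open>The travelling wave\<close>

text \<open>The Cauchy product: the products of terms are absolutely summable over all pairs (j, k),
  and the pairs are regrouped by the total index n = j + k.\<close>

lemma fourier_series_mult_has_sum:
  assumes "wsummable \<sigma> f" "wsummable \<sigma> g" "2 * pi * \<bar>Im x\<bar> \<le> \<sigma>"
  shows "((\<lambda>n. (\<Sum>\<^sub>\<infinity>j. f j * g (n - j)) * mode n x) has_sum fourier_series f x * fourier_series g x) UNIV"
proof -
  let ?f = "\<lambda>n. f n * mode n x" and ?g = "\<lambda>n. g n * mode n x"
  note F = fourier_series_has_sum[OF assms(1,3)] and G = fourier_series_has_sum[OF assms(2,3)]
  have rows: "((\<lambda>k. (case (j, k) of (j, k) \<Rightarrow> ?f j * ?g k)) has_sum ?f j * fourier_series g x) UNIV" for j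
    using has_sum_cmult_right[OF G, of "?f j"] by simp
  have "(\<lambda>p. norm (case p of (j, k) \<Rightarrow> ?f j * ?g k)) summable_on (UNIV \<times> UNIV)"
  proof (rule summable_on_SigmaI)
    show "((\<lambda>k. norm (case (j, k) of (j, k) \<Rightarrow> ?f j * ?g k)) has_sum norm (?f j) * (\<Sum>\<^sub>\<infinity>k. norm (?g k))) UNIV" for j
      using has_sum_cmult_right[OF has_sum_infsum[OF fourier_series_abs_summable[OF assms(2,3)]], of "norm (?f j)"]
      by (simp add: norm_mult)
    show "(\<lambda>j. norm (?f j) * (\<Sum>\<^sub>\<infinity>k. norm (?g k))) summable_on UNIV"
      by (intro summable_on_cmult_left fourier_series_abs_summable[OF assms(1,3)])
  qed auto
  then have "(\<lambda>(j, k). ?f j * ?g k) summable_on (UNIV \<times> UNIV)"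
    by (rule abs_summable_summable)
  then have prod: "((\<lambda>(j, k). ?f j * ?g k) has_sum fourier_series f x * fourier_series g x) (UNIV \<times> UNIV)"
    by (intro has_sum_SigmaI[OF rows] has_sum_cmult_left F) auto
  have *: "((\<lambda>(n, j). f j * g (n - j) * mode n x) has_sum fourier_series f x * fourier_series g x) (UNIV \<times> UNIV)"
  proof (rule has_sum_reindex_bij_witness[where i = "\<lambda>(j, k). (j + k, j)" and j = "\<lambda>(n, j). (j, n - j)", THEN iffD2, OF _ _ _ _ _ _ prod])
    show "(case (case a of (n, j) \<Rightarrow> (j, n - j)) of (j, k) \<Rightarrow> ?f j * ?g k) = (case a of (n, j) \<Rightarrow> f j * g (n - j) * mode n x)" for a
      using mode_add_index[of "snd a" "fst a - snd a" x] by (auto simp: case_prod_unfold)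
  qed auto
  show ?thesis
  proof (rule has_sum_Sigma'[OF *])
    fix n :: int
    have "(\<lambda>j. f j * g (n - j) * mode n x) summable_on UNIV"
      using summable_on_SigmaD1[OF has_sum_imp_summable[OF *], of n] by simp
    then show "((\<lambda>j. case (n, j) of (n, j) \<Rightarrow> f j * g (n - j) * mode n x) has_sum (\<Sum>\<^sub>\<infinity>j. f j * g (n - j)) * mode n x) UNIV"
      by (simp add: has_sum_iff infsum_cmult_left')
  qed
qed

lemma strip_series_rotate:
  assumes "x \<in> strip \<rho>"
  shows "strip_series \<rho> (rotate_coeff t f) x = strip_series \<rho> f (x + of_real t)"
  using assms by (simp add: strip_series_def strip_def fourier_series_def rotate_coeff_def mode_add mult_ac)

lemma cnj_mode_of_real: "cnj (mode n (of_real x)) = mode (- n) (of_real x)"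
  by (simp add: mode_def exp_cnj)

lemma fourier_series_real:
  assumes "\<And>n. f (- n) = cnj (f n)"
  shows "fourier_series f (of_real x) \<in> \<real>"
proof -
  have "cnj (fourier_series f (of_real x)) = (\<Sum>\<^sub>\<infinity>n. cnj (f n * mode n (of_real x)))"
    by (simp only: fourier_series_def infsum_cnj)
  also have "\<dots> = (\<Sum>\<^sub>\<infinity>n. f (- n) * mode (- n) (of_real x))"
    by (simp add: assms cnj_mode_of_real)
  also have "\<dots> = fourier_series f (of_real x)"
    unfolding fourier_series_def
    by (rule infsum_reindex_bij_witness[where i = uminus and j = uminus]) auto
  finally show ?thesis by (simp add: Reals_cnj_iff)
qed

lemma strip_series_rotate_real:
  assumes "\<And>n. f (- n) = cnj (f n)"
  shows "strip_series \<rho> (rotate_coeff t f) (of_real x) \<in> \<real>"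
proof -
  have "rotate_coeff t f (- n) = cnj (rotate_coeff t f n)" for n
    by (simp add: rotate_coeff_def assms cnj_mode_of_real)
  then show ?thesis by (simp add: strip_series_def fourier_series_real)
qed

text \<open>For positive \<open>s\<close> and \<open>A = 1\<close> these are the Fourier
  coefficients of the Weierstrass function of the lattice Z + (i s / pi) Z, taken half an imaginary
  period off the real axis, with its mean removed and divided by -2 pi^2. Its nearest poles are at
  height s / (2 pi).\<close>

definition wave_v :: "real \<Rightarrow> real \<Rightarrow> int \<Rightarrow> complex" where
  "wave_v A s n = of_real (A * csch_coeff s n)"

definition wave_u :: "real \<Rightarrow> real \<Rightarrow> real \<Rightarrow> real \<Rightarrow> int \<Rightarrow> complex" where
  "wave_u w d A s n = - of_real w * wave_v A s n + (if n = 0 then of_real d else 0)"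

lemma wsummable_wave_v:
  assumes "0 < s" "\<sigma> < s"
  shows "wsummable \<sigma> (wave_v A s)"
proof -
  let ?c = "2 / (1 - exp (- 2 * s))"
  have "wsummable \<sigma> (\<lambda>n. of_real (csch_coeff s n))"
    unfolding wsummable_def
  proof (rule summable_on_comparison_test)
    show "(\<lambda>n::int. ?c * (\<bar>of_int n\<bar> ^ 1 * exp (- ((s - \<sigma>) * \<bar>of_int n\<bar>)))) summable_on UNIV"
      by (intro summable_on_cmult_right power_exp_abs_int_summable) (use assms in simp)
    fix n :: int
    have "\<bar>csch_coeff s n\<bar> * exp (\<sigma> * \<bar>of_int n\<bar>) \<le>
        ?c * (\<bar>of_int n\<bar> * exp (- (s * \<bar>of_int n\<bar>))) * exp (\<sigma> * \<bar>of_int n\<bar>)"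
      by (intro mult_right_mono csch_coeff_le assms) auto
    also have "\<dots> = ?c * (\<bar>of_int n\<bar> ^ 1 * exp (- ((s - \<sigma>) * \<bar>of_int n\<bar>)))"
      by (simp add: left_diff_distrib exp_diff exp_minus divide_inverse)
    finally show "cmod (of_real (csch_coeff s n)) * exp (\<sigma> * \<bar>of_int n\<bar>) \<le>
        ?c * (\<bar>of_int n\<bar> ^ 1 * exp (- ((s - \<sigma>) * \<bar>of_int n\<bar>)))" by simp
  qed auto
  from wsummable_cmult[OF this, of "of_real A"] show ?thesis
    by (simp add: wave_v_def[abs_def])
qed

lemma wsummable_const_mode: "wsummable \<sigma> (\<lambda>n. if n = 0 then c else 0)"
  by (rule wsummable_finite) (rule finite_subset[of _ "{0}"], auto)

lemma wsummable_wave_u: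
  assumes "0 < s" "\<sigma> < s"
  shows "wsummable \<sigma> (wave_u w d A s)"
  unfolding wave_u_def[abs_def]
  by (intro wsummable_add wsummable_cmult wsummable_wave_v wsummable_const_mode assms)

lemma const_mode_has_sum: "((\<lambda>n. (if n = 0 then c else 0) * mode n x) has_sum c) UNIV"
  by (rule has_sum_finite_neutralI[of "{0}"]) auto

text \<open>Compared mode by mode, \<open>csch_convolution\<close> says that the square of the wave
  is a quadratic polynomial in \<open>n\<close> times its coefficients. The value of
  \<open>w * A\<close> turns n^2 / 3 into 4 pi^2 \<mu> n^2, which is -\<mu> times the second
  derivative; the terms of degree 0 in \<open>n\<close> give the linear term.\<close>

lemma wave_v_ode:
  assumes s: "0 < s" "2 * pi * \<rho> < s" and wA: "w * A = 12 * pi\<^sup>2 * \<mu>"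
  obtains e :: complex where "\<And>x. x \<in> strip \<rho> \<Longrightarrow>
    of_real w * strip_series \<rho> (wave_v A s) x ^ 2 =
      e - of_real \<mu> * strip_series \<rho> (diff_coeff (diff_coeff (wave_v A s))) x
        - of_real (4 * pi\<^sup>2 * \<mu> * (1 - 6 * coth_moment s)) * strip_series \<rho> (wave_v A s) x"
proof
  obtain \<sigma> where \<sigma>: "2 * pi * \<rho> < \<sigma>" "\<sigma> < s" using dense[OF s(2)] by blast
  obtain \<tau> where \<tau>: "\<sigma> < \<tau>" "\<tau> < s" using dense[OF \<sigma>(2)] by blast
  let ?f = "wave_v A s" and ?\<alpha> = "4 * pi\<^sup>2 * \<mu> * (1 - 6 * coth_moment s)"
  let ?conv = "\<lambda>n. \<Sum>\<^sub>\<infinity>j. ?f j * ?f (n - j)"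
  \<comment> \<open>Mode 0 lies outside the convolution identity. There both linear terms vanish, so
    the mean of the square is simply the constant of integration.\<close>
  define e where "e = of_real w * ?conv 0"
  have conv: "of_real w * ?conv n = (if n = 0 then e else 0) +
      (- of_real \<mu> * diff_coeff (diff_coeff ?f) n + - of_real ?\<alpha> * ?f n)" for n
  proof (cases "n = 0")
    case False
    let ?c = "csch_coeff s n * ((of_int n ^ 2 - 1) / 3 + 2 * coth_moment s)"
    have "((\<lambda>j. A\<^sup>2 * (csch_coeff s j * csch_coeff s (n - j))) has_sum A\<^sup>2 * ?c) UNIV"
      by (intro has_sum_cmult_right csch_convolution s False)
    from has_sum_of_real[OF this, where 'a = complex] have "?conv n = of_real (A\<^sup>2 * ?c)"
      by (intro infsumI) (simp add: wave_v_def power2_eq_square mult_ac)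
    then have "of_real w * ?conv n = of_real (w * A * (A * ?c))"
      by (simp add: power2_eq_square)
    also have "w * A * (A * ?c) = - \<mu> * (- (4 * pi\<^sup>2 * of_int n ^ 2) * (A * csch_coeff s n)) - ?\<alpha> * (A * csch_coeff s n)"
      unfolding wA by (simp add: field_simps)
    also have "of_real \<dots> = - of_real \<mu> * diff_coeff (diff_coeff ?f) n + - of_real ?\<alpha> * ?f n"
      by (simp add: diff_coeff_def wave_v_def power2_eq_square algebra_simps)
    finally show ?thesis using False by simp
  qed (simp add: e_def diff_coeff_def wave_v_def)
  fix x assume x: "x \<in> strip \<rho>"
  note f\<sigma> = wsummable_wave_v[OF s(1) \<sigma>(2)]
  \<comment> \<open>Each of the two derivatives needs a strict loss of rate, so two further rates
    are inserted between \<sigma> and \<open>s\<close>.\<close>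
  have ddf: "wsummable \<sigma> (diff_coeff (diff_coeff ?f))"
    by (rule wsummable_diff_coeff[OF wsummable_diff_coeff[OF wsummable_wave_v[OF s(1), of "(\<tau> + s) / 2"]]])
       (use \<tau> in auto)
  have "((\<lambda>n. ?conv n * mode n x) has_sum strip_series \<rho> ?f x ^ 2) UNIV"
    using fourier_series_mult_has_sum[OF f\<sigma> f\<sigma> less_imp_le[OF in_stripD[OF x \<sigma>(1)]]] x
    by (simp add: strip_series_def power2_eq_square)
  from has_sum_cmult_right[OF this, of "of_real w"]
  have 1: "((\<lambda>n. of_real w * ?conv n * mode n x) has_sum of_real w * strip_series \<rho> ?f x ^ 2) UNIV"
    by (simp add: mult.assoc)
  have "((\<lambda>n. (if n = 0 then e else 0) * mode n x +
      (- of_real \<mu> * (diff_coeff (diff_coeff ?f) n * mode n x) + - of_real ?\<alpha> * (?f n * mode n x))) has_sum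
      (e + (- of_real \<mu> * strip_series \<rho> (diff_coeff (diff_coeff ?f)) x + - of_real ?\<alpha> * strip_series \<rho> ?f x))) UNIV"
    by (intro has_sum_add has_sum_cmult_right const_mode_has_sum strip_series_has_sum[OF \<sigma>(1) _ x] ddf f\<sigma>)
  also have "(\<lambda>n. (if n = 0 then e else 0) * mode n x +
      (- of_real \<mu> * (diff_coeff (diff_coeff ?f) n * mode n x) + - of_real ?\<alpha> * (?f n * mode n x))) =
      (\<lambda>n. of_real w * ?conv n * mode n x)"
    unfolding conv by (simp only: distrib_right mult.assoc)
  finally show "of_real w * strip_series \<rho> ?f x ^ 2 =
      e - of_real \<mu> * strip_series \<rho> (diff_coeff (diff_coeff ?f)) x - of_real ?\<alpha> * strip_series \<rho> ?f x"
    using has_sum_unique[OF 1] by simp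
qed

text \<open>The value of \<open>d\<close> is the one for which u v = \<mu> v'' + (1 - w^2) v - e by
  the profile equation. Its derivative cancels the linear terms -v' - \<mu> v''' and leaves -w^2 v'
  = w u'. The second equation, -u' = w v', holds because \<open>u\<close> is a constant minus
  \<open>w\<close> times \<open>v\<close>.\<close>

lemma boussinesq_travelling_wave:
  assumes s: "0 < s" "2 * pi * \<rho> < s" and wA: "w * A = 12 * pi\<^sup>2 * \<mu>"
    and d: "d = 1 - w\<^sup>2 - 4 * pi\<^sup>2 * \<mu> * (1 - 6 * coth_moment s)"
    and x: "x \<in> strip \<rho>"
  shows "boussinesq \<mu> (pair_series \<rho> (rotate_coeff t (wave_u w d A s)) (rotate_coeff t (wave_v A s))) x =
    w *\<^sub>R pair_series \<rho> (rotate_coeff t (diff_coeff (wave_u w d A s))) (rotate_coeff t (diff_coeff (wave_v A s))) x"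
proof -
  obtain \<sigma> where \<sigma>: "2 * pi * \<rho> < \<sigma>" "\<sigma> < s" using dense[OF s(2)] by blast
  define f where "f = rotate_coeff t (wave_u w d A s)"
  define g where "g = rotate_coeff t (wave_v A s)"
  let ?\<alpha> = "4 * pi\<^sup>2 * \<mu> * (1 - 6 * coth_moment s)"
  have f: "wsummable \<sigma> f" and g: "wsummable \<sigma> g"
    by (simp_all add: f_def g_def wsummable_wave_u wsummable_wave_v s(1) \<sigma>(2))
  have fg: "f n = - of_real w * g n + (if n = 0 then of_real d else 0)" for n
    by (auto simp: f_def g_def rotate_coeff_def wave_u_def)
  have dfg: "strip_series \<rho> (diff_coeff f) = (\<lambda>x. - of_real w * strip_series \<rho> (diff_coeff g) x)"
  proof -
    have "diff_coeff f = (\<lambda>n. - of_real w * diff_coeff g n)"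
      by (rule ext) (simp add: diff_coeff_def fg)
    moreover obtain \<tau> where "2 * pi * \<rho> < \<tau>" "wsummable \<tau> (diff_coeff g)"
      using strip_series_deriv_n(2)[OF \<sigma>(1) g, of 1] by auto
    ultimately show ?thesis using strip_series_cmult by metis
  qed
  have u: "strip_series \<rho> f y = - of_real w * strip_series \<rho> g y + of_real d" if "y \<in> strip \<rho>" for y
  proof -
    have "((\<lambda>n. f n * mode n y) has_sum - of_real w * strip_series \<rho> g y + of_real d) UNIV"
      using has_sum_add[OF has_sum_cmult_right[OF strip_series_has_sum[OF \<sigma>(1) g that], of "- of_real w"]
          const_mode_has_sum[of "of_real d" y]]
      by (simp only: fg distrib_right mult.assoc)
    then show ?thesis using strip_series_has_sum[OF \<sigma>(1) f that] has_sum_unique by blast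
  qed
  obtain e where e: "\<And>x. x \<in> strip \<rho> \<Longrightarrow>
    of_real w * strip_series \<rho> (wave_v A s) x ^ 2 =
      e - of_real \<mu> * strip_series \<rho> (diff_coeff (diff_coeff (wave_v A s))) x
        - of_real ?\<alpha> * strip_series \<rho> (wave_v A s) x"
    using wave_v_ode[OF s wA] by metis
  \<comment> \<open>The profile equation has constant coefficients and a real shift preserves the
    strip, so the equation passes to every translate.\<close>
  have ode: "of_real w * strip_series \<rho> g y ^ 2 =
      e - of_real \<mu> * strip_series \<rho> (diff_coeff (diff_coeff g)) y - of_real ?\<alpha> * strip_series \<rho> g y"
    if "y \<in> strip \<rho>" for y
    using e[of "y + of_real t"] that
    by (simp add: g_def rotate_diff_coeff[symmetric] strip_series_rotate) (simp add: strip_def)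
  have uv: "strip_series \<rho> f y * strip_series \<rho> g y =
      of_real \<mu> * (deriv ^^ 2) (strip_series \<rho> g) y + of_real (1 - w\<^sup>2) * strip_series \<rho> g y - e"
    if "y \<in> strip \<rho>" for y
  proof -
    have "strip_series \<rho> f y * strip_series \<rho> g y =
        of_real d * strip_series \<rho> g y - of_real w * strip_series \<rho> g y ^ 2"
      unfolding u[OF that] by (simp add: power2_eq_square algebra_simps)
    also have "\<dots> = of_real \<mu> * strip_series \<rho> (diff_coeff (diff_coeff g)) y + of_real (1 - w\<^sup>2) * strip_series \<rho> g y - e"
      unfolding ode[OF that] d by (simp add: algebra_simps)
    also have "diff_coeff (diff_coeff g) = (diff_coeff ^^ 2) g"
      by (simp add: numeral_2_eq_2)
    finally show ?thesis using strip_series_deriv_n(1)[OF \<sigma>(1) g that] by simp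
  qed
  note v' = strip_series_deriv[OF \<sigma>(1) g x] and u' = strip_series_deriv[OF \<sigma>(1) f x]
  have v3: "((deriv ^^ 2) (strip_series \<rho> g) has_field_derivative (deriv ^^ 3) (strip_series \<rho> g) x) (at x)"
  proof -
    obtain \<tau> where \<tau>: "2 * pi * \<rho> < \<tau>" "wsummable \<tau> ((diff_coeff ^^ 2) g)"
      using strip_series_deriv_n(2)[OF \<sigma>(1) g, of 2] by auto
    have "((deriv ^^ 2) (strip_series \<rho> g) has_field_derivative strip_series \<rho> (diff_coeff ((diff_coeff ^^ 2) g)) x) (at x)"
      by (rule has_field_derivative_transform_within_open[OF strip_series_deriv[OF \<tau> x] open_strip x])
         (simp only: strip_series_deriv_n(1)[OF \<sigma>(1) g])
    then show ?thesis
      using strip_series_deriv_n(1)[OF \<sigma>(1) g x, of 3] by (simp add: numeral_3_eq_3 numeral_2_eq_2)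
  qed
  have "((\<lambda>y. of_real \<mu> * (deriv ^^ 2) (strip_series \<rho> g) y + of_real (1 - w\<^sup>2) * strip_series \<rho> g y - e)
      has_field_derivative (of_real \<mu> * (deriv ^^ 3) (strip_series \<rho> g) x +
        of_real (1 - w\<^sup>2) * strip_series \<rho> (diff_coeff g) x - 0)) (at x)"
    by (intro DERIV_add DERIV_diff DERIV_cmult DERIV_const v3 v')
  then have "((\<lambda>y. strip_series \<rho> f y * strip_series \<rho> g y)
      has_field_derivative (of_real \<mu> * (deriv ^^ 3) (strip_series \<rho> g) x +
        of_real (1 - w\<^sup>2) * strip_series \<rho> (diff_coeff g) x - 0)) (at x)"
    by (rule has_field_derivative_transform_within_open[OF _ open_strip x]) (simp only: uv)
  note uv' = DERIV_imp_deriv[OF this]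
  have "boussinesq \<mu> (pair_series \<rho> f g) x =
    w *\<^sub>R pair_series \<rho> (diff_coeff f) (diff_coeff g) x"
    unfolding boussinesq_def Let_def pair_series_def comp_def fst_conv snd_conv
    unfolding uv' DERIV_imp_deriv[OF v'] DERIV_imp_deriv[OF u'] dfg
    by (simp add: scaleR_conv_of_real power2_eq_square algebra_simps)
  then show ?thesis by (simp add: f_def g_def rotate_diff_coeff)
qed

text \<open>The amplitude \<open>A\<close> and the mean \<open>d\<close> are solved for in terms of
  the prescribed frequency, so any nonzero frequency is reached. Positivity of \<mu> makes
  \<open>A\<close>, and with it the first mode, nonzero.\<close>

lemma wave_embedding:
  fixes \<omega> :: "real ^ 'l::finite"
  assumes UNIV1: "(UNIV :: 'l set) = {i0}" and "\<rho> > 0" "\<mu> > 0" and w: "\<omega> $ i0 \<noteq> 0"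
  obtains K :: "real ^ 'l \<Rightarrow> state" and DK where
    "analytic_torus_embedding \<rho> m K DK" "\<And>\<theta>. real_on_axis (K \<theta>)" "invariance_equation \<rho> \<mu> K DK \<omega>"
proof -
  \<comment> \<open>Any value above 2 pi \<rho> would do; adding 2 leaves room for the rate \<sigma>
    = 2 pi \<rho> + 1 in between.\<close>
  define s where "s = 2 * pi * \<rho> + 2"
  define w where "w = \<omega> $ i0"
  define A where "A = 12 * pi\<^sup>2 * \<mu> / w"
  define d where "d = 1 - w\<^sup>2 - 4 * pi\<^sup>2 * \<mu> * (1 - 6 * coth_moment s)"
  define f where "f = wave_u w d A s"
  define g where "g = wave_v A s"
  have s: "0 < s" "2 * pi * \<rho> < s" using assms(2) by (simp_all add: s_def add_pos_pos)
  have wA: "w * A = 12 * pi\<^sup>2 * \<mu>" and A: "A \<noteq> 0"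
    using w assms(3) by (simp_all add: A_def w_def)
  define \<sigma> where "\<sigma> = 2 * pi * \<rho> + 1"
  have \<sigma>: "2 * pi * \<rho> < \<sigma>" "\<sigma> < s" by (simp_all add: \<sigma>_def s_def)
  show ?thesis
  proof (rule that)
    show "analytic_torus_embedding \<rho> m
      (\<lambda>\<theta> :: real ^ 'l. pair_series \<rho> (rotate_coeff (\<theta> $ i0) f) (rotate_coeff (\<theta> $ i0) g))
      (\<lambda>\<theta> j. pair_series \<rho> (rotate_coeff (\<theta> $ i0) (diff_coeff f)) (rotate_coeff (\<theta> $ i0) (diff_coeff g)))"
    proof (rule analytic_torus_embedding_rotate[OF UNIV1 assms(2) \<sigma>(1)])
      show "g 1 \<noteq> 0" using A csch_coeff_nonzero[OF s(1), of 1] by (simp add: g_def wave_v_def)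
    qed (simp_all add: f_def g_def wsummable_wave_u wsummable_wave_v s(1) \<sigma>(2))
    have "f (- n) = cnj (f n)" "g (- n) = cnj (g n)" for n
      by (simp_all add: f_def g_def wave_u_def wave_v_def)
    then show "real_on_axis (pair_series \<rho> (rotate_coeff (\<theta> $ i0) f) (rotate_coeff (\<theta> $ i0) g))" for \<theta> :: "real ^ 'l"
      by (simp add: real_on_axis_def pair_series_def strip_series_rotate_real)
    show "invariance_equation \<rho> \<mu>
      (\<lambda>\<theta> :: real ^ 'l. pair_series \<rho> (rotate_coeff (\<theta> $ i0) f) (rotate_coeff (\<theta> $ i0) g))
      (\<lambda>\<theta> j. pair_series \<rho> (rotate_coeff (\<theta> $ i0) (diff_coeff f)) (rotate_coeff (\<theta> $ i0) (diff_coeff g))) \<omega>"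
      using boussinesq_travelling_wave[OF s wA d_def]
      by (simp add: invariance_equation_def lin_map_def UNIV1 f_def g_def w_def[symmetric])
  qed
qed

section \<open>One-dimensional Diophantine sets and their density\<close>

lemma diophantine_dim_1:
  fixes i0 :: "'l::finite"
  assumes UNIV1: "(UNIV :: 'l set) = {i0}" and "\<kappa> > 0" "\<nu> \<ge> 0"
  shows "(diophantine \<kappa> \<nu> :: (real ^ 'l) set) = - ball 0 (1 / \<kappa>)"
proof (intro set_eqI iffI)
  have norm1: "norm \<omega> = \<bar>\<omega> $ i0\<bar>" for \<omega> :: "real ^ 'l"
    by (simp add: norm_vec_def L2_set_def UNIV1)
  fix \<omega> :: "real ^ 'l"
  {
    assume "\<omega> \<in> diophantine \<kappa> \<nu>"
    \<comment> \<open>Testing with the integer vector 1 already excludes the interval around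
      0.\<close>
    moreover have "(\<chi> i. (1 :: int)) \<noteq> (0 :: int ^ 'l)" by (simp add: vec_eq_iff)
    ultimately have "\<omega> $ i0 \<noteq> 0" "inverse \<bar>\<omega> $ i0\<bar> \<le> \<kappa>"
      unfolding diophantine_def Let_def by (force simp: UNIV1)+
    then show "\<omega> \<in> - ball 0 (1 / \<kappa>)"
      using assms(2) by (simp add: norm1 field_simps)
  }
  assume "\<omega> \<in> - ball 0 (1 / \<kappa>)"
  then have le: "1 / \<kappa> \<le> \<bar>\<omega> $ i0\<bar>" by (simp add: norm1)
  then have pos: "\<bar>\<omega> $ i0\<bar> > 0" using assms(2) by (smt (verit) divide_pos_pos)
  \<comment> \<open>Conversely |k| = 1 is the worst case: a larger |k| decreases the left side and
    does not decrease the right side, since \<nu> is nonnegative.\<close>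
  have "inverse \<bar>\<omega> $ i0 * of_int (k $ i0)\<bar> \<le> \<kappa> * \<bar>of_int (k $ i0)\<bar> powr \<nu>" if "k $ i0 \<noteq> 0" for k :: "int ^ 'l"
  proof -
    have k1: "\<bar>real_of_int (k $ i0)\<bar> \<ge> 1" using that by linarith
    have "inverse \<bar>\<omega> $ i0 * of_int (k $ i0)\<bar> \<le> inverse (1 / \<kappa> * 1)"
      unfolding abs_mult using assms(2) by (intro le_imp_inverse_le mult_mono le k1) auto
    also have "\<dots> = \<kappa> * 1" by simp
    also have "\<dots> \<le> \<kappa> * \<bar>of_int (k $ i0)\<bar> powr \<nu>"
      using assms k1 by (intro mult_left_mono ge_one_powr_ge_zero) auto
    finally show ?thesis .
  qed
  moreover have "k $ i0 \<noteq> 0" if "k \<noteq> 0" for k :: "int ^ 'l"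
    using that UNIV1 by (metis UNIV_I singletonD vec_eq_iff zero_index)
  ultimately show "\<omega> \<in> diophantine \<kappa> \<nu>"
    using pos by (auto simp: diophantine_def Let_def UNIV1)
qed

text \<open>In dimension one the removed ball has length 2 \<epsilon>^2, a fraction \<epsilon> of
  the length 2 \<epsilon>, wherever the centre \<open>c\<close> lies.\<close>

lemma measure_ball_diff_ge:
  fixes c :: "real ^ 'l::finite"
  assumes "CARD('l) = 1" "\<epsilon> > 0"
  shows "1 - \<epsilon> \<le> measure lebesgue (- ball 0 (\<epsilon>\<^sup>2) \<inter> ball c \<epsilon>) / measure lebesgue (ball c \<epsilon>)"
proof -
  have ball: "measure lebesgue (ball c r) = 2 * r" if "r \<ge> 0" for c :: "real ^ 'l" and r
    using content_ball[OF that, of c] assms(1) by (simp add: measure_completion)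
  have eq: "ball c \<epsilon> - ball 0 (\<epsilon>\<^sup>2) = - ball 0 (\<epsilon>\<^sup>2) \<inter> ball c \<epsilon>" by auto
  have "measure lebesgue (ball c \<epsilon>) - measure lebesgue (ball 0 (\<epsilon>\<^sup>2) :: (real ^ 'l) set)
      \<le> measure lebesgue (ball c \<epsilon> - ball 0 (\<epsilon>\<^sup>2))"
    by (rule measure_diff_le_measure_setdiff) auto
  then have "2 * \<epsilon> - 2 * \<epsilon>\<^sup>2 \<le> measure lebesgue (- ball 0 (\<epsilon>\<^sup>2) \<inter> ball c \<epsilon>)"
    unfolding eq using ball[of \<epsilon> c] ball[of "\<epsilon>\<^sup>2" 0] assms(2) by simp
  then have "(1 - \<epsilon>) * (2 * \<epsilon>) \<le> measure lebesgue (- ball 0 (\<epsilon>\<^sup>2) \<inter> ball c \<epsilon>)"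
    by (simp add: algebra_simps power2_eq_square)
  then show ?thesis
    unfolding ball[OF less_imp_le[OF assms(2)]] using assms(2) by (subst pos_le_divide_eq) auto
qed

theorem theorem3p9:
  fixes \<mu> \<rho> \<nu> :: real and k :: "'l::finite \<Rightarrow> int"
  assumes "\<mu> > 0" and "\<rho> > 0"
    and "bij_betw k UNIV (central_modes \<mu>)"
    and "card (central_modes \<mu>) = 1"
    and "\<nu> > real (card (central_modes \<mu>))"
  shows "\<exists>m0::nat. \<forall>m\<ge>m0. \<exists>(a :: real \<Rightarrow> real) (b_d :: real \<Rightarrow> real) (b_a :: real \<Rightarrow> real).
     (\<forall>s>0. a s > 0 \<and> b_d s > 0 \<and> b_a s > 0) \<and>
     (a \<longlongrightarrow> 0) (at_right 0) \<and>
     filterlim b_d at_top (at_right 0) \<and>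
     filterlim b_a at_top (at_right 0) \<and>
     (\<exists>\<epsilon>0>0. \<forall>\<epsilon>. 0 < \<epsilon> \<and> \<epsilon> < \<epsilon>0 \<longrightarrow>
        (\<forall>\<omega> \<in> diophantine (b_d \<epsilon>) \<nu> \<inter> ball (central_freq \<mu> k) (a \<epsilon>).
           \<exists>(K :: real ^ 'l \<Rightarrow> state) DK.
             analytic_torus_embedding \<rho> m K DK \<and>
             (\<forall>\<theta>. real_on_axis (K \<theta>)) \<and>
             invariance_equation \<rho> \<mu> K DK \<omega>)) \<and>
     ((\<lambda>\<epsilon>. measure lebesgue (diophantine (b_d \<epsilon>) \<nu> \<inter> ball (central_freq \<mu> k) (a \<epsilon>)) /
           measure lebesgue (ball (central_freq \<mu> k) (a \<epsilon>))) \<longlongrightarrow> 1) (at_right 0)"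
\<comment> \<open>The choice a(s) = s and b_d(s) = 1 / s^2 makes the excluded radius 1 / b_d small
  compared with a; b_a(s) = 1 / s. The waves lie in X for every \<open>m\<close>, so the regularity
  threshold is 0.\<close>
proof (rule exI[of _ 0], intro allI impI, rule exI[of _ "\<lambda>s. s"], rule exI[of _ "\<lambda>s. 1 / s\<^sup>2"],
    rule exI[of _ "\<lambda>s. 1 / s"], intro conjI)
  have card: "CARD('l) = 1" using bij_betw_same_card[OF assms(3)] assms(4) by simp
  then obtain i0 where UNIV1: "(UNIV :: 'l set) = {i0}" by (auto simp: card_1_singleton_iff)
  have diophantine: "(diophantine (1 / \<epsilon>\<^sup>2) \<nu> :: (real ^ 'l) set) = - ball 0 (\<epsilon>\<^sup>2)" if "\<epsilon> > 0" for \<epsilon>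
    using diophantine_dim_1[OF UNIV1, of "1 / \<epsilon>\<^sup>2" \<nu>] that assms(4,5) by simp
  show "((\<lambda>s::real. s) \<longlongrightarrow> 0) (at_right 0)" by (rule tendsto_ident_at)
  show inv: "filterlim (\<lambda>s::real. 1 / s) at_top (at_right 0)"
    by (simp add: divide_inverse filterlim_inverse_at_top_right)
  show "filterlim (\<lambda>s::real. 1 / s\<^sup>2) at_top (at_right 0)"
    using filterlim_at_top_mult_at_top[OF inv inv] by (simp add: power2_eq_square)
  have "\<exists>(K :: real ^ 'l \<Rightarrow> state) DK. analytic_torus_embedding \<rho> m K DK \<and>
      (\<forall>\<theta>. real_on_axis (K \<theta>)) \<and> invariance_equation \<rho> \<mu> K DK \<omega>"
    if "0 < \<epsilon>" "\<omega> \<in> diophantine (1 / \<epsilon>\<^sup>2) \<nu>" for \<omega> \<epsilon> m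
  proof -
    \<comment> \<open>The Diophantine condition enters the existence proof only through the
      exclusion of the frequency 0.\<close>
    have "\<omega> \<noteq> 0" using that diophantine[of \<epsilon>] by auto
    then have "\<omega> $ i0 \<noteq> 0" using UNIV1 by (metis UNIV_I singletonD vec_eq_iff zero_index)
    from wave_embedding[OF UNIV1 assms(2,1) this] show ?thesis by metis
  qed
  then show "\<exists>\<epsilon>0>0. \<forall>\<epsilon>. 0 < \<epsilon> \<and> \<epsilon> < \<epsilon>0 \<longrightarrow>
      (\<forall>\<omega>\<in>diophantine (1 / \<epsilon>\<^sup>2) \<nu> \<inter> ball (central_freq \<mu> k) \<epsilon>.
        \<exists>(K :: real ^ 'l \<Rightarrow> state) DK. analytic_torus_embedding \<rho> m K DK \<and>
          (\<forall>\<theta>. real_on_axis (K \<theta>)) \<and> invariance_equation \<rho> \<mu> K DK \<omega>)" for m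
    \<comment> \<open>Existence holds for every positive \<epsilon>, so the threshold 1 is
      arbitrary.\<close>
    by (intro exI[of _ 1]) auto
  show "((\<lambda>\<epsilon>. measure lebesgue (diophantine (1 / \<epsilon>\<^sup>2) \<nu> \<inter> ball (central_freq \<mu> k) \<epsilon>) /
      measure lebesgue (ball (central_freq \<mu> k) \<epsilon>)) \<longlongrightarrow> 1) (at_right 0)"
  proof (rule real_tendsto_sandwich)
    show "\<forall>\<^sub>F \<epsilon> in at_right 0. 1 - \<epsilon> \<le> measure lebesgue (diophantine (1 / \<epsilon>\<^sup>2) \<nu> \<inter> ball (central_freq \<mu> k) \<epsilon>) /
        measure lebesgue (ball (central_freq \<mu> k) \<epsilon>)"
      using eventually_at_right_less[of "0::real"]
      by eventually_elim (simp only: diophantine measure_ball_diff_ge[OF card])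
    show "\<forall>\<^sub>F \<epsilon> in at_right 0. measure lebesgue (diophantine (1 / \<epsilon>\<^sup>2) \<nu> \<inter> ball (central_freq \<mu> k) \<epsilon>) /
        measure lebesgue (ball (central_freq \<mu> k) \<epsilon>) \<le> 1"
      using eventually_at_right_less[of "0::real"]
    proof eventually_elim
      case (elim \<epsilon>)
      have "measure lebesgue (- ball 0 (\<epsilon>\<^sup>2) \<inter> ball (central_freq \<mu> k) \<epsilon>) \<le> measure lebesgue (ball (central_freq \<mu> k) \<epsilon>)"
        by (rule measure_mono_fmeasurable) auto
      then show ?case unfolding diophantine[OF elim] by (intro divide_le_eq_1[THEN iffD2]) (use elim in \<open>auto simp: measure_completion\<close>)
    qed
    show "((\<lambda>\<epsilon>::real. 1 - \<epsilon>) \<longlongrightarrow> 1) (at_right 0)"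
      using tendsto_diff[OF tendsto_const[of "1::real"] tendsto_ident_at[of 0 "{0<..}"]] by simp
  qed simp
qed simp

end
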